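(* Let $b$ be a locally integrable function on $\mathbb{R}^n$, let $\mu\in A_1$ and $0<\beta<1$. Suppose that $1<p<n/\beta$, $1/q=1/p-\beta/n$ and $0<\kappa<p/q$. Then the following assertions are equivalent: (1) $b\in Lip_{\beta,\mu}$. (2) The maximal commutator $M_b$ is bounded from $L^{p,\kappa}(\mu)$ to $L^{q,\kappa q/p}(\mu^{1-q},\mu)$, i.e. there is $C>0$ with $\|M_b(f)\|_{L^{q,\kappa q/p}(\mu^{1-q},\mu)}\le C\|f\|_{L^{p,\kappa}(\mu)}$ for all $f\in L^{p,\kappa}(\mu)$.
   Context: Cubes $Q\subset\mathbb{R}^n$ have sides parallel to the axes; $|Q|$ is Lebesgue measure, $f_Q=|Q|^{-1}\int_Q f$. A weight is a nonnegative locally integrable function taking values in $(0,\infty)$ a.e.; for a weight $\mu$, $\mu(Q)=\int_Q\mu(x)\,dx$. $\mu\in A_1$ means there is $C>0$ such that for every cube $Q$, $\frac{1}{|Q|}\int_Q\mu(y)\,dy\le C\mu(x)$ for a.e. $x\in Q$. For $0<\beta<1$ and $\mu\in A_1$, $Lip_{\beta,\mu}$ is the space of locally integrable $f$ with $\|f\|_{Lip_{\beta,\mu}}=\sup_Q \frac{1}{\mu(Q)^{\beta/n}}\frac{1}{\mu(Q)}\int_Q|f(x)-f_Q|\,dx<\infty$. For $1\le p<\infty$, $0<\kappa<1$ and weights $u,v$, the weighted Morrey space $L^{p,\kappa}(u,v)$ consists of $f\in L^p_{loc}(u)$ with $\|f\|_{L^{p,\kappa}(u,v)}=\sup_Q\big(\frac{1}{v(Q)^\kappa}\int_Q|f(x)|^pu(x)\,dx\big)^{1/p}<\infty$;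 $L^{p,\kappa}(\mu)=L^{p,\kappa}(\mu,\mu)$. The maximal commutator is $M_b(f)(x)=\sup_{Q\ni x}\frac{1}{|Q|}\int_Q|b(x)-b(y)||f(y)|\,dy$, the supremum over all cubes containing $x$. *)

theory Defs
  imports "HOL-Analysis.Analysis"
begin

text \<open>Cubes with sides parallel to the axes (closed; boundaries are null sets).\<close>
definition cubes :: "'a::euclidean_space set set" where
  "cubes = {cbox a (a + r *\<^sub>R One) | a r. r > 0}"

definition locally_integrable :: "('a::euclidean_space \<Rightarrow> real) \<Rightarrow> bool" where
  "locally_integrable f \<longleftrightarrow> (\<forall>K. compact K \<longrightarrow> set_integrable lebesgue K f)"

definition weight :: "('a::euclidean_space \<Rightarrow> real) \<Rightarrow> bool" where
  "weight w \<longleftrightarrow> locally_integrable w \<and> (\<forall>x. 0 \<le> w x) \<and> (AE x in lebesgue. 0 < w x)"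

definition wmeas :: "('a::euclidean_space \<Rightarrow> real) \<Rightarrow> 'a set \<Rightarrow> real" where
  "wmeas w Q = (LINT x:Q|lebesgue. w x)"

definition avg :: "('a::euclidean_space \<Rightarrow> real) \<Rightarrow> 'a set \<Rightarrow> real" where
  "avg f Q = (LINT x:Q|lebesgue. f x) / measure lebesgue Q"

definition A1 :: "('a::euclidean_space \<Rightarrow> real) \<Rightarrow> bool" where
  "A1 w \<longleftrightarrow> weight w \<and>
     (\<exists>C>0. \<forall>Q\<in>cubes. AE x in lebesgue. x \<in> Q \<longrightarrow> avg w Q \<le> C * w x)"

definition Lip_w :: "real \<Rightarrow> ('a::euclidean_space \<Rightarrow> real) \<Rightarrow> ('a \<Rightarrow> real) set" where
  "Lip_w \<beta> \<mu> = {f. locally_integrable f \<and>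
     (\<exists>B. \<forall>Q\<in>cubes. 1 / wmeas \<mu> Q powr (\<beta> / real DIM('a)) * (1 / wmeas \<mu> Q)
            * (LINT x:Q|lebesgue. \<bar>f x - avg f Q\<bar>) \<le> B)}"

text \<open>Real powers of extended nonnegative reals (exponent assumed positive).\<close>
definition enn_powr :: "ennreal \<Rightarrow> real \<Rightarrow> ennreal" where
  "enn_powr a r = (if a = \<infinity> then \<infinity> else ennreal (enn2real a powr r))"

definition morrey_norm :: "real \<Rightarrow> real \<Rightarrow> ('a::euclidean_space \<Rightarrow> real) \<Rightarrow> ('a \<Rightarrow> real)
     \<Rightarrow> ('a \<Rightarrow> ennreal) \<Rightarrow> ennreal" where
  "morrey_norm p \<kappa> u v g =
     (SUP Q\<in>cubes. enn_powr (ennreal (1 / wmeas v Q powr \<kappa>) *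
        (\<integral>\<^sup>+ x\<in>Q. enn_powr (g x) p * ennreal (u x) \<partial>lebesgue)) (1 / p))"

definition morrey_space :: "real \<Rightarrow> real \<Rightarrow> ('a::euclidean_space \<Rightarrow> real) \<Rightarrow> ('a \<Rightarrow> real)
     \<Rightarrow> ('a \<Rightarrow> real) set" where
  "morrey_space p \<kappa> u v = {f. f \<in> borel_measurable lebesgue \<and>
     (\<forall>K. compact K \<longrightarrow> (\<integral>\<^sup>+ x\<in>K. ennreal (\<bar>f x\<bar> powr p * u x) \<partial>lebesgue) < \<infinity>) \<and>
     morrey_norm p \<kappa> u v (\<lambda>x. ennreal \<bar>f x\<bar>) < \<infinity>}"

definition max_comm :: "('a::euclidean_space \<Rightarrow> real) \<Rightarrow> ('a \<Rightarrow> real) \<Rightarrow> 'a \<Rightarrow> ennreal" where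
  "max_comm b f x = (SUP Q\<in>{Q\<in>cubes. x \<in> Q}.
      ennreal (1 / measure lebesgue Q) *
      (\<integral>\<^sup>+ y\<in>Q. ennreal (\<bar>b x - b y\<bar> * \<bar>f y\<bar>) \<partial>lebesgue))"

end

theory Submission
  imports Defs
begin

text \<open>
  Write \<open>\<nu>\<close> for the measure with density \<open>\<mu>\<close> and \<open>\<alpha> = \<beta>/n\<close>. If \<open>b\<close> lies in the weighted Lipschitz class,
  telescoping the averages of \<open>b\<close> over cubes shrinking to a Lebesgue point \<open>x\<close>, with the reverse
  doubling of \<open>\<nu>\<close> making the series geometric, gives
  \<open>\<bar>b x - b\<^sub>Q\<bar> \<le> K \<nu>(Q)\<^sup>\<alpha> \<mu> x\<close> for almost all \<open>x\<close> and all cubes \<open>Q\<close> containing \<open>x\<close>. With the A1 condition, the maximal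
  commutator is then at most a constant times \<open>\<mu> x\<close> times the supremum of
  \<open>\<nu>(P)\<^sup>\<alpha>\<close> times the \<open>\<nu>\<close>-average of \<open>\<bar>f\<bar>\<close> over the cubes \<open>P\<close> containing \<open>x\<close>. To estimate this on a cube \<open>Q\<close>,
  the cubes \<open>P\<close> larger than \<open>Q\<close> are controlled by the Morrey norm alone, and the smaller ones
  by Hedberg's trick and the strong \<open>(p, p)\<close> bound for the maximal function of \<open>\<nu>\<close>.
  Conversely, testing the boundedness on the indicator of \<open>Q\<close>, where the maximal commutator
  dominates \<open>\<bar>b - b\<^sub>Q\<bar>\<close>, and applying Hoelder's inequality recovers the Lipschitz condition.
\<close>

subsection \<open>Cubes\<close>

text \<open>The weight \<open>\<mu> x powr (1 - q)\<close> is what moves the problem onto \<nu>: the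
  pointwise bound for \<open>max_comm b f\<close> carries a factor \<open>\<mu> x\<close>, and the
  q-th power of this factor times that weight is \<open>\<mu> x\<close> again. What remains is a
  fractional maximal operator on a doubling measure. The condition \<kappa> < p / q makes the
  exponent \<kappa> / p - 1 / q negative; since a cube that meets Q and is larger than Q has, up to
  a constant, larger \<nu>-measure, such cubes are harmless. Two obstacles shape the statements. The
  operators are suprema over uncountably many cubes, whereas the A1 condition has one exceptional
  null set per cube; a countable family that encloses every cube, at most doubling its side,
  restores a single null set and yields a measurable maximal function. The maximal commutator itself
  is never shown measurable: its integrals are compared only by monotonicity. Hoelder's inequality
  appears as the pointwise bound t \<le> u + t^q u^(1-q), with u chosen so that both terms have the
  same order after integration.\<close>

definition cube :: "'a::euclidean_space \<Rightarrow> real \<Rightarrow> 'a set" where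
  "cube a r = cbox a (a + r *\<^sub>R One)"

lemma mem_cube: "x \<in> cube a r \<longleftrightarrow> (\<forall>i\<in>Basis. a \<bullet> i \<le> x \<bullet> i \<and> x \<bullet> i \<le> a \<bullet> i + r)"
  by (simp add: cube_def mem_box inner_add_left)

lemma cubes_iff: "Q \<in> cubes \<longleftrightarrow> (\<exists>a r. r > 0 \<and> Q = cube a r)"
  by (auto simp: cubes_def cube_def)

lemma cube_in_cubes [simp]: "r > 0 \<Longrightarrow> cube a r \<in> cubes"
  by (auto simp: cubes_iff)

lemma compact_cube [simp]: "compact (cube a r)"
  by (simp add: cube_def)

lemma cube_sets [measurable, simp]: "cube a r \<in> sets lebesgue"
  by (simp add: cube_def)

lemma corner_in_cube: "r \<ge> 0 \<Longrightarrow> a \<in> cube a r"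
  by (simp add: mem_cube)

lemma measure_cube: "r \<ge> 0 \<Longrightarrow> measure lebesgue (cube a r) = r ^ DIM('a)"
  for a :: "'a::euclidean_space"
  by (subst measure_completion, simp add: cube_def)
     (simp add: cube_def content_cbox inner_add_left)

lemma emeasure_cube_finite: "emeasure lebesgue (cube a r) < \<infinity>"
  by (simp add: cube_def emeasure_lborel_cbox_eq)

section \<open>Inclusions between cubes and the Vitali covering argument\<close>

lemma cube_subset_double:
  assumes "x \<in> cube a r" "0 \<le> s" "s \<le> r"
  shows "cube x s \<subseteq> cube a (2 * r)"
  unfolding subset_iff mem_cube
proof (intro allI impI ballI)
  fix t and i :: 'a assume t: "\<forall>i\<in>Basis. x \<bullet> i \<le> t \<bullet> i \<and> t \<bullet> i \<le> x \<bullet> i + s" "i \<in> Basis"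
  with assms show "a \<bullet> i \<le> t \<bullet> i \<and> t \<bullet> i \<le> a \<bullet> i + 2 * r"
    using mem_cube[of x a r] by force
qed

lemma cube_mono: "r \<le> s \<Longrightarrow> cube a r \<subseteq> cube a s"
  by (force simp: subset_iff mem_cube)

text \<open>The larger cube on the right is the concentric triple of \<open>cube a r\<close>: the
  corner moves down by r and the side becomes 3r. A cube of side at most r that touches the original
  sticks out by at most r in each coordinate direction.\<close>

lemma cube_subset_triple:
  assumes "cube c s \<inter> cube a r \<noteq> {}" "s \<le> r"
  shows "cube c s \<subseteq> cube (a - r *\<^sub>R One) (3 * r)"
proof -
  obtain z where z: "z \<in> cube c s" "z \<in> cube a r"
    using assms by blast
  show ?thesis
    unfolding subset_iff mem_cube
  proof (intro allI impI ballI)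
    fix t and i :: 'a assume t: "\<forall>i\<in>Basis. c \<bullet> i \<le> t \<bullet> i \<and> t \<bullet> i \<le> c \<bullet> i + s" "i \<in> Basis"
    have "c \<bullet> i \<le> t \<bullet> i" "t \<bullet> i \<le> c \<bullet> i + s" using t by auto
    moreover have "a \<bullet> i \<le> z \<bullet> i" "z \<bullet> i \<le> a \<bullet> i + r" "c \<bullet> i \<le> z \<bullet> i" "z \<bullet> i \<le> c \<bullet> i + s"
      using z t by (auto simp: mem_cube)
    ultimately show "(a - r *\<^sub>R One) \<bullet> i \<le> t \<bullet> i \<and> t \<bullet> i \<le> (a - r *\<^sub>R One) \<bullet> i + 3 * r"
      using t(2) assms(2) by (simp add: inner_diff_left)
  qed
qed

text \<open>Greedy selection: a cube of maximal side absorbs, in its triple, every cube that meets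
  it; the induction then selects among the cubes disjoint from it.\<close>

lemma finite_vitali_cubes:
  fixes F :: "('a::euclidean_space \<times> real) set"
  assumes "finite F" "\<And>a r. (a, r) \<in> F \<Longrightarrow> 0 < r"
  shows "\<exists>G\<subseteq>F. disjoint_family_on (\<lambda>(a, r). cube a r) G \<and>
      (\<Union>(a, r)\<in>F. cube a r) \<subseteq> (\<Union>(a, r)\<in>G. cube (a - r *\<^sub>R One) (3 * r))"
  using assms
proof (induction F rule: finite_psubset_induct)
  case (psubset F)
  show ?case
  proof (cases "F = {}")
    case True then show ?thesis by (auto simp: disjoint_family_on_def)
  next
    case False
    then have "Max (snd ` F) \<in> snd ` F" using psubset.hyps by simp
    then obtain a r where ar: "(a, r) \<in> F" "r = Max (snd ` F)" by force
    have max: "s \<le> r" if "(c, s) \<in> F" for c s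
      unfolding ar(2) using psubset.hyps that by (metis Max_ge finite_imageI image_eqI snd_conv)
    define F' where "F' = {(c, s) \<in> F. cube c s \<inter> cube a r = {}}"
    have "0 < r" using ar psubset.prems by blast
    then have "(a, r) \<notin> F'" using corner_in_cube[of r a] by (auto simp: F'_def)
    with ar have "F' \<subset> F" by (auto simp: F'_def)
    moreover have "\<And>c s. (c, s) \<in> F' \<Longrightarrow> 0 < s" using psubset.prems by (auto simp: F'_def)
    ultimately obtain G where G: "G \<subseteq> F'" "disjoint_family_on (\<lambda>(a, r). cube a r) G"
      "(\<Union>(a, r)\<in>F'. cube a r) \<subseteq> (\<Union>(a, r)\<in>G. cube (a - r *\<^sub>R One) (3 * r))"
      using psubset.IH by meson
    show ?thesis
    proof (intro exI[of _ "insert (a, r) G"] conjI)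
      show "insert (a, r) G \<subseteq> F" using G(1) ar by (auto simp: F'_def)
      show "disjoint_family_on (\<lambda>(a, r). cube a r) (insert (a, r) G)"
        using G(1,2) by (fastforce simp: disjoint_family_on_def F'_def)
      show "(\<Union>(a, r)\<in>F. cube a r) \<subseteq>
          (\<Union>(a, r)\<in>insert (a, r) G. cube (a - r *\<^sub>R One) (3 * r))"
      proof clarify
        fix x c s assume cs: "(c, s) \<in> F" "x \<in> cube c s"
        show "x \<in> (\<Union>(a, r)\<in>insert (a, r) G. cube (a - r *\<^sub>R One) (3 * r))"
        proof (cases "cube c s \<inter> cube a r = {}")
          case True
          then have "x \<in> (\<Union>(a, r)\<in>F'. cube a r)" using cs by (auto simp: F'_def)
          then show ?thesis using G(3) by auto
        next
          case False
          from cube_subset_triple[OF this max[OF cs(1)]] cs show ?thesis by auto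
        qed
      qed
    qed
  qed
qed

section \<open>A countable family of cubes enclosing all others\<close>

definition dense_set :: "'a::euclidean_space set" where
  "dense_set = (SOME D. countable D \<and> (\<forall>X. open X \<longrightarrow> X \<noteq> {} \<longrightarrow> (\<exists>d\<in>D. d \<in> X)))"

lemma dense_set: "countable (dense_set :: 'a::euclidean_space set)"
  "open X \<Longrightarrow> X \<noteq> {} \<Longrightarrow> \<exists>d\<in>dense_set. d \<in> (X :: 'a set)"
  using someI_ex[OF countable_dense_exists[where 'a='a], folded dense_set_def] by auto

text \<open>Countability allows null sets to be united and suprema to stay measurable; results for
  arbitrary cubes follow by enclosing them, at the price of powers of 2.\<close>

definition rat_cubes :: "('a::euclidean_space \<times> real) set" where
  "rat_cubes = dense_set \<times> {r \<in> \<rat>. 0 < r}"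

lemma countable_rat_cubes: "countable rat_cubes"
  unfolding rat_cubes_def
  by (intro countable_SIGMA dense_set countable_subset[OF _ countable_rat]) auto

lemma rat_cubes_pos: "(a, r) \<in> rat_cubes \<Longrightarrow> 0 < r"
  by (simp add: rat_cubes_def)

lemma rat_cube_superset:
  fixes a :: "'a::euclidean_space"
  assumes "0 < r"
  obtains c s where "(c, s) \<in> rat_cubes" "cube a r \<subseteq> cube c s" "r \<le> s" "s \<le> 2 * r"
proof -
  have "box (a - (r / 4) *\<^sub>R One) a \<noteq> {}"
    using assms by (auto simp: box_ne_empty inner_diff_left)
  then obtain c where c: "c \<in> dense_set" "c \<in> box (a - (r / 4) *\<^sub>R One) a"
    using dense_set(2)[OF open_box] by blast
  \<comment> \<open>The corner c may lie up to r/4 below a, so the side has to exceed 5r/4 for the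
    far face to clear a + r.\<close>
  obtain s where s: "s \<in> \<rat>" "5 * r / 4 < s" "s < 2 * r"
    using Rats_dense_in_real[of "5 * r / 4" "2 * r"] assms by auto
  have "cube a r \<subseteq> cube c s"
    unfolding subset_iff mem_cube
  proof (intro allI impI ballI)
    fix t and i :: 'a assume t: "\<forall>i\<in>Basis. a \<bullet> i \<le> t \<bullet> i \<and> t \<bullet> i \<le> a \<bullet> i + r" "i \<in> Basis"
    have "a \<bullet> i \<le> t \<bullet> i" "t \<bullet> i \<le> a \<bullet> i + r" using t by auto
    moreover have "a \<bullet> i - r / 4 < c \<bullet> i" "c \<bullet> i < a \<bullet> i"
      using c(2) t(2) by (auto simp: mem_box inner_diff_left)
    ultimately show "c \<bullet> i \<le> t \<bullet> i \<and> t \<bullet> i \<le> c \<bullet> i + s"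
      using s by linarith
  qed
  with c s assms show thesis
    by (intro that[of c s]) (auto simp: rat_cubes_def)
qed

subsection \<open>Powers of extended nonnegative reals\<close>

lemma enn_powr_ennreal: "0 \<le> a \<Longrightarrow> enn_powr (ennreal a) r = ennreal (a powr r)"
  by (simp add: enn_powr_def)

lemma enn_powr_mono: "a \<le> b \<Longrightarrow> 0 \<le> r \<Longrightarrow> enn_powr a r \<le> enn_powr b r"
  by (cases a rule: ennreal_cases; cases b rule: ennreal_cases)
     (auto simp: enn_powr_def top_unique intro!: ennreal_leI powr_mono2)

lemma enn_powr_measurable [measurable]:
  assumes [measurable]: "f \<in> borel_measurable M"
  shows "(\<lambda>x. enn_powr (f x) r) \<in> borel_measurable M"
  unfolding enn_powr_def by measurable

lemma enn_powr_le_imp_le: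
  assumes "0 < r" "0 \<le> c" "enn_powr a r \<le> ennreal c"
  shows "a \<le> ennreal (c powr (1 / r))"
proof (cases a rule: ennreal_cases)
  case (real x)
  then have "x powr r \<le> c" using assms by (simp add: enn_powr_ennreal)
  then have "(x powr r) powr (1 / r) \<le> c powr (1 / r)" using assms by (intro powr_mono2) auto
  then show ?thesis using real assms by (simp add: powr_powr ennreal_leI)
next
  case top
  then show ?thesis using assms by (simp add: enn_powr_def top_unique)
qed

text \<open>If t exceeds u, then (t/u)^(q-1) is at least 1 and the second term alone dominates.
  After integration and a choice of u this serves in place of Hoelder's inequality.\<close>

lemma le_add_powr:
  fixes t u :: real
  assumes "0 \<le> t" "0 < u" "1 \<le> q"
  shows "t \<le> u + t powr q * u powr (1 - q)"
proof (cases "t \<le> u")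
  case True
  then show ?thesis by (simp add: add_increasing2)
next
  case False
  have "t = t powr q * t powr (1 - q)" using False assms by (simp add: powr_add[symmetric])
  also have "\<dots> \<le> t powr q * u powr (1 - q)"
    using False assms by (intro mult_left_mono powr_mono2') auto
  finally show ?thesis using assms by linarith
qed

subsection \<open>Locally integrable functions\<close>

lemma locally_integrable_measurable:
  assumes "locally_integrable f"
  shows "f \<in> borel_measurable lebesgue"
proof (rule borel_measurable_LIMSEQ_real)
  show "(\<lambda>x. indicator (cball 0 (real n)) x *\<^sub>R f x) \<in> borel_measurable lebesgue" for n
    using assms unfolding locally_integrable_def set_integrable_def
    by (meson borel_measurable_integrable compact_cball)
  fix x
  show "(\<lambda>n. indicator (cball 0 (real n)) x *\<^sub>R f x) \<longlonglongrightarrow> f x"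
  proof (rule tendsto_eventually, rule eventually_mono[OF eventually_ge_at_top[of "nat \<lceil>norm x\<rceil>"]])
    fix n assume "nat \<lceil>norm x\<rceil> \<le> n"
    then have "norm x \<le> real n" by linarith
    then show "indicator (cball 0 (real n)) x *\<^sub>R f x = f x" by simp
  qed
qed

lemma set_integrable_measurable_subset:
  assumes "locally_integrable f" "E \<in> sets lebesgue" "E \<subseteq> cube a r"
  shows "set_integrable lebesgue E f"
  using assms set_integrable_subset unfolding locally_integrable_def by (metis compact_cube)

lemma set_integrable_cube [simp]: "locally_integrable f \<Longrightarrow> set_integrable lebesgue (cube a r) f"
  by (rule set_integrable_measurable_subset) auto

lemma set_integrable_const_cube [simp]: "set_integrable lebesgue (cube a r) (\<lambda>x. c :: real)"
  using emeasure_cube_finite[of a r] by (simp add: set_integrable_def integrable_mult_left)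

lemma avg_integral: "avg f Q * measure lebesgue Q = (LINT x:Q|lebesgue. f x)"
  if "measure lebesgue Q \<noteq> 0"
  using that by (simp add: avg_def)

lemma abs_diff_avg_le:
  fixes a :: "'a::euclidean_space"
  assumes "locally_integrable f" "0 < r"
  shows "\<bar>avg f (cube a r) - c\<bar> * r ^ DIM('a) \<le> (LINT x:cube a r|lebesgue. \<bar>f x - c\<bar>)"
proof -
  have m: "measure lebesgue (cube a r) = r ^ DIM('a)" using assms by (simp add: measure_cube)
  have "(LINT x:cube a r|lebesgue. f x - c)
      = (LINT x:cube a r|lebesgue. f x) - (LINT x:cube a r|lebesgue. c)"
    using assms by (intro set_integral_diff) auto
  also have "(LINT x:cube a r|lebesgue. c) = c * r ^ DIM('a)"
    using emeasure_cube_finite[of a r] m by (subst set_integral_const) auto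
  also have "(LINT x:cube a r|lebesgue. f x) = avg f (cube a r) * r ^ DIM('a)"
    using avg_integral[of "cube a r" f] m assms by simp
  finally have "\<bar>avg f (cube a r) - c\<bar> * r ^ DIM('a) = \<bar>LINT x:cube a r|lebesgue. f x - c\<bar>"
    using assms by (simp add: abs_mult flip: left_diff_distrib)
  also have "\<dots> \<le> (LINT x:cube a r|lebesgue. \<bar>f x - c\<bar>)"
    unfolding set_lebesgue_integral_def
    by (rule order_trans[OF integral_abs_bound]) (simp add: abs_mult)
  finally show ?thesis .
qed

lemma set_nn_integral_eq_set_integral:
  fixes h :: "_ \<Rightarrow> real"
  assumes "set_integrable M Q h" "\<And>x. 0 \<le> h x"
  shows "(\<integral>\<^sup>+x\<in>Q. ennreal (h x) \<partial>M) = ennreal (LINT x:Q|M. h x)"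
proof -
  have "(\<integral>\<^sup>+x\<in>Q. ennreal (h x) \<partial>M) = (\<integral>\<^sup>+x. ennreal (indicator Q x *\<^sub>R h x) \<partial>M)"
    by (intro nn_integral_cong) (auto split: split_indicator)
  also have "\<dots> = ennreal (LINT x:Q|M. h x)"
    unfolding set_lebesgue_integral_def using assms
    by (intro nn_integral_eq_integral) (auto simp: set_integrable_def)
  finally show ?thesis .
qed

lemma set_integrable_abs_diff_cube [simp]:
  fixes f :: "'a::euclidean_space \<Rightarrow> real"
  assumes "locally_integrable f"
  shows "set_integrable lebesgue (cube a r) (\<lambda>x. \<bar>f x - c\<bar>)"
  using assms by (intro set_integrable_abs set_integral_diff) auto

subsection \<open>Muckenhoupt weights of class A1\<close>

text \<open>The normalisation \<open>1 \<le> C\<close> is obtained by enlarging the A1 constant. It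
  keeps the reverse doubling constant \<delta> positive.\<close>

locale A1_weight =
  fixes \<mu> :: "'a::euclidean_space \<Rightarrow> real" and C :: real
  assumes weight: "weight \<mu>" and C_ge_1: "1 \<le> C"
    and A1: "Q \<in> cubes \<Longrightarrow> AE x in lebesgue. x \<in> Q \<longrightarrow> avg \<mu> Q \<le> C * \<mu> x"
begin

abbreviation w :: "'a \<Rightarrow> real \<Rightarrow> real" where
  "w a r \<equiv> wmeas \<mu> (cube a r)"

definition \<nu> :: "'a measure" where
  "\<nu> = density lebesgue (\<lambda>x. ennreal (\<mu> x))"

lemma loc_int: "locally_integrable \<mu>" and nonneg [simp]: "0 \<le> \<mu> x"
  and AE_pos: "AE x in lebesgue. 0 < \<mu> x"
  using weight by (auto simp: weight_def)

lemma measurable_weight [measurable]: "\<mu> \<in> borel_measurable lebesgue"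
  by (rule locally_integrable_measurable[OF loc_int])

lemma sets_\<nu> [measurable_cong, simp]: "sets \<nu> = sets lebesgue"
  by (simp add: \<nu>_def)

lemma space_\<nu> [simp]: "space \<nu> = UNIV"
  by (simp add: \<nu>_def)

lemma nn_integral_\<nu>:
  "f \<in> borel_measurable lebesgue \<Longrightarrow> (\<integral>\<^sup>+x. f x \<partial>\<nu>) = (\<integral>\<^sup>+x. ennreal (\<mu> x) * f x \<partial>lebesgue)"
  unfolding \<nu>_def by (rule nn_integral_density) auto

lemma wmeas_nonneg [simp]: "0 \<le> wmeas \<mu> E"
  by (simp add: wmeas_def set_lebesgue_integral_def)

lemma emeasure_\<nu>:
  assumes "E \<in> sets lebesgue" "E \<subseteq> cube a r"
  shows "emeasure \<nu> E = ennreal (wmeas \<mu> E)"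
proof -
  have "emeasure \<nu> E = (\<integral>\<^sup>+x. ennreal (\<mu> x) * indicator E x \<partial>lebesgue)"
    unfolding \<nu>_def using assms by (intro emeasure_density) auto
  also have "\<dots> = (\<integral>\<^sup>+x. ennreal (indicator E x *\<^sub>R \<mu> x) \<partial>lebesgue)"
    by (intro nn_integral_cong) (auto split: split_indicator)
  also have "\<dots> = ennreal (wmeas \<mu> E)"
    unfolding wmeas_def set_lebesgue_integral_def
    using set_integrable_measurable_subset[OF loc_int assms]
    by (intro nn_integral_eq_integral) (auto simp: set_integrable_def)
  finally show ?thesis .
qed

lemma emeasure_\<nu>_cube: "emeasure \<nu> (cube a r) = ennreal (w a r)"
  by (rule emeasure_\<nu>) auto

lemma wmeas_mono:
  assumes "E \<in> sets lebesgue" "F \<in> sets lebesgue" "E \<subseteq> F" "F \<subseteq> cube a r"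
  shows "wmeas \<mu> E \<le> wmeas \<mu> F"
proof -
  have "emeasure \<nu> E \<le> emeasure \<nu> F" using assms by (intro emeasure_mono) auto
  then show ?thesis
    using assms wmeas_nonneg by (simp add: emeasure_\<nu>[of _ a r])
qed

lemma w_pos:
  assumes "0 < r"
  shows "0 < w a r"
proof (rule ccontr)
  assume "\<not> 0 < w a r"
  then have "emeasure \<nu> (cube a r) = 0"
    using wmeas_nonneg[of "cube a r"] by (simp add: emeasure_\<nu>_cube ennreal_eq_0_iff)
  then have "(\<integral>\<^sup>+x. ennreal (\<mu> x) * indicator (cube a r) x \<partial>lebesgue) = 0"
    by (simp add: \<nu>_def emeasure_density)
  then have "AE x in lebesgue. ennreal (\<mu> x) * indicator (cube a r) x = 0"
    by (subst (asm) nn_integral_0_iff_AE) auto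
  with AE_pos have "AE x in lebesgue. x \<notin> cube a r"
    by eventually_elim (auto simp: ennreal_eq_0_iff split: split_indicator_asm)
  then have "emeasure lebesgue (cube a r) = 0"
    by (subst (asm) AE_iff_measurable[of "cube a r"]) auto
  then show False
    using assms measure_cube[of r a] by (simp add: measure_def)
qed

text \<open>Integrating the A1 inequality over E alone compares relative \<nu>-measure with relative
  Lebesgue measure. Taking E to be a subcube gives doubling; taking E to be the complement of a half
  cube gives reverse doubling.\<close>

lemma wmeas_subset:
  assumes "E \<in> sets lebesgue" "E \<subseteq> cube a r" "0 < r"
  shows "w a r * measure lebesgue E \<le> C * r ^ DIM('a) * wmeas \<mu> E"
proof -
  have E: "emeasure lebesgue E < \<infinity>"
    using emeasure_cube_finite[of a r] assms by (meson cube_sets emeasure_mono le_less_trans)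
  have "avg \<mu> (cube a r) * measure lebesgue E = (LINT x:E|lebesgue. avg \<mu> (cube a r))"
    using E assms by (subst set_integral_const) auto
  also have "\<dots> \<le> (LINT x:E|lebesgue. C * \<mu> x)"
  proof (rule set_integral_mono_AE)
    show "set_integrable lebesgue E (\<lambda>x. avg \<mu> (cube a r))"
      using set_integrable_subset[OF set_integrable_const_cube assms(1,2)] .
    show "set_integrable lebesgue E (\<lambda>x. C * \<mu> x)"
      using set_integrable_measurable_subset[OF loc_int assms(1,2)] by simp
    show "AE x\<in>E in lebesgue. avg \<mu> (cube a r) \<le> C * \<mu> x"
      using A1[OF cube_in_cubes[OF assms(3), of a]]
      by (rule eventually_mono) (use assms(2) in auto)
  qed
  also have "\<dots> = C * wmeas \<mu> E" by (simp add: wmeas_def)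
  finally show ?thesis
    using assms(3) by (simp add: avg_def wmeas_def measure_cube field_simps)
qed

section \<open>Doubling and reverse doubling of the weighted measure\<close>

lemma w_doubling:
  assumes "cube c s \<subseteq> cube a r" "0 < s" "r \<le> k * s" "0 < r"
  shows "w a r \<le> C * k ^ DIM('a) * w c s"
proof -
  have "w a r * s ^ DIM('a) \<le> C * r ^ DIM('a) * w c s"
    using wmeas_subset[of "cube c s" a r] assms by (simp add: measure_cube)
  also have "\<dots> \<le> C * (k * s) ^ DIM('a) * w c s"
    using assms C_ge_1 wmeas_nonneg by (intro mult_right_mono mult_left_mono power_mono) auto
  finally show ?thesis
    using assms by (simp add: power_mult_distrib field_simps)
qed

lemma w_mono: "cube c s \<subseteq> cube a r \<Longrightarrow> w c s \<le> w a r"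
  by (rule wmeas_mono) auto

text \<open>Removing from a cube the half-size cube at its corner leaves the fraction 1 - 2^(-n) of
  the volume, hence at least that fraction divided by C of the weighted measure; \<delta> bounds
  what the half cube can retain.\<close>

definition \<delta> :: real where
  "\<delta> = 1 - (1 - 1 / 2 ^ DIM('a)) / C"

lemma delta: "0 < \<delta>" "\<delta> < 1"
proof -
  have *: "0 < 1 - 1 / (2::real) ^ DIM('a)" "1 - 1 / (2::real) ^ DIM('a) < 1"
    using one_less_power[of "2::real" "DIM('a)"] by auto
  then have "(1 - 1 / 2 ^ DIM('a)) / C \<le> (1 - 1 / 2 ^ DIM('a)) / 1"
    using C_ge_1 by (intro divide_left_mono) auto
  then have "(1 - 1 / 2 ^ DIM('a)) / C < 1"
    unfolding div_by_1 using *(2) by (rule le_less_trans)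
  then show "0 < \<delta>" by (simp only: \<delta>_def diff_gt_0_iff_gt)
  show "\<delta> < 1" using * C_ge_1 by (simp add: \<delta>_def)
qed

lemma w_half:
  assumes "0 < r"
  shows "w a (r / 2) \<le> \<delta> * w a r"
proof -
  let ?Q = "cube a r" and ?R = "cube a (r / 2)"
  have sub: "?R \<subseteq> ?Q" using assms by (intro cube_mono) auto
  have fin: "emeasure lebesgue ?Q \<noteq> \<infinity>" "emeasure lebesgue ?R \<noteq> \<infinity>"
    using emeasure_cube_finite less_top by auto
  have "measure lebesgue (?Q - ?R) = r ^ DIM('a) - (r / 2) ^ DIM('a)"
    using assms sub fin by (subst measure_Diff) (auto simp: measure_cube)
  also have "\<dots> = r ^ DIM('a) * (1 - 1 / 2 ^ DIM('a))"
    by (simp add: power_divide field_simps)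
  finally have "w a r * (r ^ DIM('a) * (1 - 1 / 2 ^ DIM('a))) \<le> C * r ^ DIM('a) * wmeas \<mu> (?Q - ?R)"
    using wmeas_subset[of "?Q - ?R" a r] assms by auto
  then have "r ^ DIM('a) * (w a r * (1 - 1 / 2 ^ DIM('a))) \<le> r ^ DIM('a) * (C * wmeas \<mu> (?Q - ?R))"
    by (simp add: mult_ac)
  then have "w a r * (1 - 1 / 2 ^ DIM('a)) \<le> C * wmeas \<mu> (?Q - ?R)"
    using assms by (subst (asm) mult_le_cancel_left_pos) auto
  moreover have "w a r = w a (r / 2) + wmeas \<mu> (?Q - ?R)"
    using sub set_integral_Un[of ?R "?Q - ?R" lebesgue \<mu>] loc_int
      set_integrable_measurable_subset[OF loc_int, of "?Q - ?R" a r]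
    by (auto simp: wmeas_def Un_absorb1)
  ultimately show ?thesis
    using C_ge_1 unfolding \<delta>_def by (simp add: field_simps)
qed

text \<open>The quantifier over cubes stands inside the almost-everywhere statement. It suffices to
  discard the null sets of the rational cubes; the enclosing rational cube has side at most 2r,
  whence the factor 2^n.\<close>

lemma AE_w_le:
  "AE x in lebesgue. \<forall>a r. 0 < r \<longrightarrow> x \<in> cube a r \<longrightarrow> w a r \<le> C * 2 ^ DIM('a) * r ^ DIM('a) * \<mu> x"
proof -
  have "AE x in lebesgue. \<forall>(a, r)\<in>rat_cubes. x \<in> cube a r \<longrightarrow> avg \<mu> (cube a r) \<le> C * \<mu> x"
    by (intro AE_ball_countable' countable_rat_cubes) (auto intro!: A1 cube_in_cubes rat_cubes_pos)
  then show ?thesis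
  proof eventually_elim
    case (elim x)
    show ?case
    proof (intro allI impI)
      fix a r assume "0 < r" "x \<in> cube a r"
      from rat_cube_superset[OF \<open>0 < r\<close>, of a] obtain c s where
        cs: "(c, s) \<in> rat_cubes" "cube a r \<subseteq> cube c s" "r \<le> s" "s \<le> 2 * r" by metis
      have "w a r \<le> w c s" by (rule w_mono[OF cs(2)])
      also have "\<dots> \<le> s ^ DIM('a) * (C * \<mu> x)"
        using elim cs \<open>x \<in> cube a r\<close> \<open>0 < r\<close>
        by (auto simp: avg_def wmeas_def measure_cube field_simps dest!: bspec)
      also have "\<dots> \<le> (2 * r) ^ DIM('a) * (C * \<mu> x)"
        using cs \<open>0 < r\<close> C_ge_1 by (intro mult_right_mono power_mono) auto
      finally show "w a r \<le> C * 2 ^ DIM('a) * r ^ DIM('a) * \<mu> x"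
        by (simp add: power_mult_distrib mult_ac)
    qed
  qed
qed

end

subsection \<open>Dyadic sums\<close>

text \<open>A discrete layer-cake bound, written as an integral over the counting measure so that it
  can be interchanged with the integral over space. A single term suffices: the one with 2^k < y
  \<le> 2^(k+1).\<close>

lemma dyadic_powr_le:
  fixes y :: ennreal
  assumes "1 < p"
  shows "enn_powr y p \<le> (\<integral>\<^sup>+k. ennreal (2 powr ((of_int k + 1) * p)) *
    indicator {k. ennreal (2 powr of_int k) < y} k \<partial>count_space (UNIV :: int set))" (is "_ \<le> ?I")
proof -
  have bound: "ennreal (2 powr ((of_int k + 1) * p)) \<le> ?I" if "ennreal (2 powr of_int k) < y" for k
    using nn_integral_ge_point[of k UNIV "\<lambda>k. ennreal (2 powr ((of_int k + 1) * p)) *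
      indicator {k. ennreal (2 powr of_int k) < y} k"] that by auto
  show ?thesis
  proof (cases y rule: ennreal_cases)
    case top
    \<comment> \<open>For infinite y every level k is present, and single terms already exceed each
      natural number.\<close>
    have "of_nat n \<le> ?I" for n
    proof -
      have "real n \<le> 2 ^ n" using of_nat_less_two_power[of n] by (simp add: less_imp_le)
      also have "\<dots> = 2 powr real n" by (simp add: powr_realpow)
      also have "\<dots> \<le> 2 powr ((real n + 1) * p)"
        using assms mult_mono[of "real n" "real n + 1" 1 p] by (intro powr_mono) auto
      finally have "ennreal (real n) \<le> ennreal (2 powr ((of_int (int n) + 1) * p))"
        by (intro ennreal_leI) simp
      also have "\<dots> \<le> ?I" using top by (intro bound) simp
      finally show ?thesis by (simp add: ennreal_of_nat_eq_real_of_nat)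
    qed
    then have "top \<le> ?I"
      unfolding ennreal_SUP_of_nat_eq_top[symmetric] by (rule SUP_least)
    then show ?thesis by (simp add: top_unique)
  next
    case (real r)
    show ?thesis
    proof (cases "r = 0")
      case True
      then show ?thesis using real by (simp add: enn_powr_def)
    next
      case False
      with real have "0 < r" by simp
      \<comment> \<open>Subtracting 1 from the ceiling makes the lower comparison strict, as the
        level sets require, and leaves the upper one non-strict.\<close>
      define k where "k = \<lceil>log 2 r\<rceil> - 1"
      have "of_int k < log 2 r" "log 2 r \<le> of_int k + 1" unfolding k_def by linarith+
      then have k: "2 powr of_int k < r" "r \<le> 2 powr (of_int k + 1)"
        using \<open>0 < r\<close> by (simp_all add: less_log_iff log_le_iff)
      have "r powr p \<le> (2 powr (of_int k + 1)) powr p"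
        using k \<open>0 < r\<close> assms by (intro powr_mono2) auto
      then have "enn_powr y p \<le> ennreal (2 powr ((of_int k + 1) * p))"
        using real by (simp add: enn_powr_ennreal powr_powr ennreal_leI)
      also have "\<dots> \<le> ?I" using k real by (intro bound) (simp add: ennreal_less_iff)
      finally show ?thesis .
    qed
  qed
qed

lemma dyadic_geometric_sum:
  fixes a s :: real
  assumes "0 < s"
  shows "(\<integral>\<^sup>+k. ennreal (2 powr (of_int k * s)) * indicator {k. 2 powr of_int k < a} k
      \<partial>count_space (UNIV :: int set)) \<le> ennreal (a powr s / (1 - 2 powr - s))"
proof (cases "0 < a")
  case False
  then have "\<not> 2 powr of_int k < a" for k :: int
    using powr_ge_zero[of 2 "of_int k"] by linarith
  then show ?thesis by simp
next
  case True
  \<comment> \<open>K is the largest admissible exponent; counting downwards from it by k = K - j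
    turns the sum into a geometric series with ratio 2^(-s).\<close>
  define K where "K = \<lceil>log 2 a\<rceil> - 1"
  have lt: "2 powr of_int k < a \<longleftrightarrow> k \<le> K" for k :: int
  proof -
    have "2 powr of_int k < a \<longleftrightarrow> of_int k < log 2 a" using True by (simp add: less_log_iff)
    then show ?thesis unfolding K_def by linarith
  qed
  have bij: "bij_betw (\<lambda>j. K - int j) UNIV {..K}"
    by (rule bij_betwI[where g = "\<lambda>k. nat (K - k)"]) auto
  have q: "0 < 2 powr - s" "2 powr - s < 1" using powr_less_mono[of "- s" 0 2] assms by auto
  have "(\<integral>\<^sup>+k. ennreal (2 powr (of_int k * s)) * indicator {k. 2 powr of_int k < a} k
      \<partial>count_space (UNIV :: int set)) = (\<integral>\<^sup>+k. ennreal (2 powr (of_int k * s)) \<partial>count_space {..K})"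
    by (simp add: nn_integral_count_space_indicator lt atMost_def)
  also have "\<dots> = (\<integral>\<^sup>+j. ennreal (2 powr (of_int (K - int j) * s)) \<partial>count_space UNIV)"
    by (rule nn_integral_bij_count_space[OF bij, symmetric])
  also have "\<dots> = (\<Sum>j. ennreal (2 powr (of_int K * s) * (2 powr - s) ^ j))"
    unfolding nn_integral_count_space_nat
  proof (intro suminf_cong arg_cong[of _ _ ennreal])
    fix j :: nat
    have "(2 powr - s) ^ j = 2 powr (- s * real j)"
      using powr_realpow[of "2 powr - s" j] by (simp add: powr_powr)
    then show "2 powr (of_int (K - int j) * s) = 2 powr (of_int K * s) * (2 powr - s) ^ j"
      by (simp add: powr_add[symmetric] algebra_simps)
  qed
  also have "\<dots> = ennreal (2 powr (of_int K * s) * (1 / (1 - 2 powr - s)))"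
    using q by (intro suminf_ennreal_eq sums_mult geometric_sums) auto
  also have "\<dots> \<le> ennreal (a powr s / (1 - 2 powr - s))"
  proof -
    have "2 powr (of_int K * s) = (2 powr of_int K) powr s" by (simp add: powr_powr)
    also have "\<dots> \<le> a powr s" using lt[of K] assms by (intro powr_mono2) auto
    finally show ?thesis using q by (intro ennreal_leI) (simp add: divide_right_mono)
  qed
  finally show ?thesis .
qed

subsection \<open>The maximal function of the weighted measure\<close>

context A1_weight
begin

lemma w_triple: "0 < r \<Longrightarrow> w (a - r *\<^sub>R One) (3 * r) \<le> C * 3 ^ DIM('a) * w a r"
  by (rule w_doubling)
     (use cube_subset_triple[of a r a r] corner_in_cube[of r a] in auto)

text \<open>The tripled selected cubes cover the union, doubling replaces the triples by the cubes
  themselves, and disjointness lets their integrals be added without exceeding the integral of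
  g.\<close>

lemma weak_type_finite:
  fixes g :: "'a \<Rightarrow> ennreal"
  assumes [measurable]: "g \<in> borel_measurable lebesgue" and "finite F"
    and pos: "\<And>a r. (a, r) \<in> F \<Longrightarrow> 0 < r"
    and large: "\<And>a r. (a, r) \<in> F \<Longrightarrow> t * emeasure \<nu> (cube a r) \<le> (\<integral>\<^sup>+x\<in>cube a r. g x \<partial>\<nu>)"
  shows "t * emeasure \<nu> (\<Union>(a, r)\<in>F. cube a r) \<le> ennreal (C * 3 ^ DIM('a)) * (\<integral>\<^sup>+x. g x \<partial>\<nu>)"
proof -
  have "\<exists>G\<subseteq>F. disjoint_family_on (\<lambda>(a, r). cube a r) G \<and>
      (\<Union>(a, r)\<in>F. cube a r) \<subseteq> (\<Union>(a, r)\<in>G. cube (a - r *\<^sub>R One) (3 * r))"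
    by (rule finite_vitali_cubes[OF \<open>finite F\<close>]) (rule pos)
  then obtain G where G: "G \<subseteq> F" "disjoint_family_on (\<lambda>(a, r). cube a r) G"
    "(\<Union>(a, r)\<in>F. cube a r) \<subseteq> (\<Union>(a, r)\<in>G. cube (a - r *\<^sub>R One) (3 * r))"
    by (elim exE conjE) (rule that)
  have "finite G" using G(1) \<open>finite F\<close> finite_subset by blast
  have "emeasure \<nu> (\<Union>(a, r)\<in>F. cube a r) \<le> emeasure \<nu> (\<Union>(a, r)\<in>G. cube (a - r *\<^sub>R One) (3 * r))"
    using \<open>finite G\<close> by (intro emeasure_mono[OF G(3)]) (auto intro!: sets.finite_UN)
  also have "\<dots> \<le> (\<Sum>(a, r)\<in>G. emeasure \<nu> (cube (a - r *\<^sub>R One) (3 * r)))"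
    using \<open>finite G\<close> emeasure_subadditive_finite[of G "\<lambda>(a, r). cube (a - r *\<^sub>R One) (3 * r)" \<nu>]
    by (auto simp: case_prod_beta image_subset_iff)
  also have "\<dots> \<le> (\<Sum>(a, r)\<in>G. ennreal (C * 3 ^ DIM('a)) * emeasure \<nu> (cube a r))"
    using G(1) pos C_ge_1
    by (intro sum_mono)
       (auto simp: emeasure_\<nu>_cube wmeas_nonneg w_triple simp flip: ennreal_mult intro!: ennreal_leI)
  finally have "t * emeasure \<nu> (\<Union>(a, r)\<in>F. cube a r) \<le>
      t * (\<Sum>(a, r)\<in>G. ennreal (C * 3 ^ DIM('a)) * emeasure \<nu> (cube a r))"
    by (rule mult_left_mono) simp
  also have "\<dots> = ennreal (C * 3 ^ DIM('a)) * (\<Sum>(a, r)\<in>G. t * emeasure \<nu> (cube a r))"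
    by (simp add: sum_distrib_left case_prod_beta mult_ac)
  also have "(\<Sum>(a, r)\<in>G. t * emeasure \<nu> (cube a r)) \<le> (\<Sum>(a, r)\<in>G. \<integral>\<^sup>+x\<in>cube a r. g x \<partial>\<nu>)"
    using G(1) large by (intro sum_mono) auto
  also have "\<dots> = (\<integral>\<^sup>+x. (\<Sum>(a, r)\<in>G. g x * indicator (cube a r) x) \<partial>\<nu>)"
    unfolding case_prod_beta by (subst nn_integral_sum) auto
  also have "\<dots> \<le> (\<integral>\<^sup>+x. g x \<partial>\<nu>)"
  proof (rule nn_integral_mono)
    fix x
    have "(indicator (\<Union>(a, r)\<in>G. cube a r) x :: ennreal) = (\<Sum>(a, r)\<in>G. indicator (cube a r) x)"
      using indicator_UN_disjoint[OF \<open>finite G\<close> G(2), of x] by (simp add: case_prod_beta)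
    then have "(\<Sum>(a, r)\<in>G. g x * indicator (cube a r) x) = g x * indicator (\<Union>(a, r)\<in>G. cube a r) x"
      by (simp add: case_prod_beta sum_distrib_left)
    also have "\<dots> \<le> g x" by (auto split: split_indicator)
    finally show "(\<Sum>(a, r)\<in>G. g x * indicator (cube a r) x) \<le> g x" .
  qed
  finally show ?thesis by (simp add: mult_left_mono)
qed

text \<open>The constant does not depend on the number of cubes, so continuity of the measure from
  below passes from finite to countable families.\<close>

lemma weak_type_union:
  fixes g :: "'a \<Rightarrow> ennreal"
  assumes "g \<in> borel_measurable lebesgue" and "S \<subseteq> rat_cubes"
    and "\<And>a r. (a, r) \<in> S \<Longrightarrow> t * emeasure \<nu> (cube a r) \<le> (\<integral>\<^sup>+x\<in>cube a r. g x \<partial>\<nu>)"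
  shows "t * emeasure \<nu> (\<Union>(a, r)\<in>S. cube a r) \<le> ennreal (C * 3 ^ DIM('a)) * (\<integral>\<^sup>+x. g x \<partial>\<nu>)"
proof (cases "S = {}")
  case False
  have "countable S" using assms(2) countable_rat_cubes countable_subset by blast
  define A where "A n = (\<Union>(a, r)\<in>from_nat_into S ` {..n}. cube a r)" for n
  have in_S: "from_nat_into S i \<in> S" for i by (rule from_nat_into[OF False])
  have "(\<Union>(a, r)\<in>S. cube a r) = (\<Union>(a, r)\<in>from_nat_into S ` UNIV. cube a r)"
    by (simp only: range_from_nat_into[OF False \<open>countable S\<close>])
  also have "\<dots> = (\<Union>n. A n)" unfolding A_def case_prod_beta by auto
  finally have "(\<Union>(a, r)\<in>S. cube a r) = (\<Union>n. A n)" .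
  moreover have "incseq A"
    unfolding A_def incseq_def by (intro allI impI UN_mono image_mono) auto
  moreover have "range A \<subseteq> sets \<nu>"
    by (auto simp: A_def case_prod_beta)
  ultimately have "emeasure \<nu> (\<Union>(a, r)\<in>S. cube a r) = (SUP n. emeasure \<nu> (A n))"
    by (simp add: SUP_emeasure_incseq)
  then have "t * emeasure \<nu> (\<Union>(a, r)\<in>S. cube a r) = (SUP n. t * emeasure \<nu> (A n))"
    by (simp add: SUP_mult_left_ennreal)
  also have "\<dots> \<le> ennreal (C * 3 ^ DIM('a)) * (\<integral>\<^sup>+x. g x \<partial>\<nu>)"
  proof (rule SUP_least)
    fix n
    have sub: "(a, r) \<in> S" if "(a, r) \<in> from_nat_into S ` {..n}" for a r
      using that in_S by (metis image_iff)
    show "t * emeasure \<nu> (A n) \<le> ennreal (C * 3 ^ DIM('a)) * (\<integral>\<^sup>+x. g x \<partial>\<nu>)"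
      unfolding A_def using sub assms rat_cubes_pos by (intro weak_type_finite) blast+
  qed
  finally show ?thesis .
qed simp

text \<open>The uncentred maximal function of \<nu>, restricted to rational cubes so that it is a
  countable supremum of measurable functions. By \<open>nn_integral_le_maximal\<close> it still
  controls averages over arbitrary cubes.\<close>

definition maximal :: "('a \<Rightarrow> ennreal) \<Rightarrow> 'a \<Rightarrow> ennreal" where
  "maximal g x = (SUP (a, r)\<in>rat_cubes.
     indicator (cube a r) x * (ennreal (1 / w a r) * (\<integral>\<^sup>+y\<in>cube a r. g y \<partial>\<nu>)))"

lemma maximal_measurable [measurable]: "maximal g \<in> borel_measurable lebesgue"
  unfolding maximal_def case_prod_beta
  by (intro borel_measurable_SUP countable_rat_cubes) auto

lemma maximal_weak_type:
  assumes "g \<in> borel_measurable lebesgue"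
  shows "ennreal t * emeasure \<nu> {x. ennreal t < maximal g x} \<le> ennreal (C * 3 ^ DIM('a)) * (\<integral>\<^sup>+x. g x \<partial>\<nu>)"
proof -
  define S where "S = {(a, r) \<in> rat_cubes. ennreal t * emeasure \<nu> (cube a r) \<le> (\<integral>\<^sup>+x\<in>cube a r. g x \<partial>\<nu>)}"
  have "{x. ennreal t < maximal g x} \<subseteq> (\<Union>(a, r)\<in>S. cube a r)"
  proof clarify
    fix x assume "ennreal t < maximal g x"
    then obtain a r where ar: "(a, r) \<in> rat_cubes"
      "ennreal t < indicator (cube a r) x * (ennreal (1 / w a r) * (\<integral>\<^sup>+y\<in>cube a r. g y \<partial>\<nu>))"
      by (auto simp: maximal_def less_SUP_iff)
    then have x: "x \<in> cube a r" by (auto split: split_indicator_asm)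
    with ar have "ennreal t \<le> ennreal (1 / w a r) * (\<integral>\<^sup>+y\<in>cube a r. g y \<partial>\<nu>)" by auto
    then have "ennreal (w a r) * ennreal t \<le>
        ennreal (w a r) * (ennreal (1 / w a r) * (\<integral>\<^sup>+y\<in>cube a r. g y \<partial>\<nu>))"
      by (rule mult_left_mono) simp
    also have "\<dots> = (\<integral>\<^sup>+y\<in>cube a r. g y \<partial>\<nu>)"
      using w_pos[OF rat_cubes_pos[OF ar(1)], of a]
      by (simp add: mult.assoc[symmetric] ennreal_mult[symmetric])
    finally show "x \<in> (\<Union>(a, r)\<in>S. cube a r)"
      using ar x by (auto simp: S_def emeasure_\<nu>_cube mult.commute)
  qed
  moreover have "countable S"
    using countable_rat_cubes by (rule countable_subset[rotated]) (auto simp: S_def)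
  ultimately have "ennreal t * emeasure \<nu> {x. ennreal t < maximal g x} \<le> ennreal t * emeasure \<nu> (\<Union>(a, r)\<in>S. cube a r)"
    by (intro mult_left_mono emeasure_mono) (auto simp: case_prod_beta intro!: sets.countable_UN')
  also have "\<dots> \<le> ennreal (C * 3 ^ DIM('a)) * (\<integral>\<^sup>+x. g x \<partial>\<nu>)"
    by (rule weak_type_union[OF assms]) (auto simp: S_def)
  finally show ?thesis .
qed

section \<open>Interpolation: from weak type to the strong bound\<close>

lemma maximal_weak_type_truncated:
  fixes g :: "'a \<Rightarrow> real"
  assumes [measurable]: "g \<in> borel_measurable lebesgue" and g: "\<And>x. 0 \<le> g x" and "0 < t"
  shows "emeasure \<nu> {x. ennreal t < maximal (\<lambda>x. ennreal (g x)) x} \<le>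
    ennreal (2 * C * 3 ^ DIM('a) / t) * (\<integral>\<^sup>+x. ennreal (g x) * indicator {x. t / 2 < g x} x \<partial>\<nu>)"
proof -
  \<comment> \<open>The part of g below height t/2 contributes at most t/2 to any average, so a
    value above t forces the maximal function of the upper part above t/2.\<close>
  let ?h = "\<lambda>x. ennreal (g x) * indicator {x. t / 2 < g x} x"
  have le: "maximal (\<lambda>x. ennreal (g x)) x \<le> maximal ?h x + ennreal (t / 2)" for x
    unfolding maximal_def
  proof (rule SUP_least, clarify)
    fix a :: 'a and r assume ar: "(a, r) \<in> rat_cubes"
    have w: "0 < w a r" using w_pos rat_cubes_pos[OF ar] by blast
    have "(\<integral>\<^sup>+y\<in>cube a r. ennreal (g y) \<partial>\<nu>) \<le>
        (\<integral>\<^sup>+y. ?h y * indicator (cube a r) y + ennreal (t / 2) * indicator (cube a r) y \<partial>\<nu>)"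
      by (intro nn_integral_mono) (auto split: split_indicator intro!: ennreal_leI)
    also have "\<dots> = (\<integral>\<^sup>+y\<in>cube a r. ?h y \<partial>\<nu>) + ennreal (t / 2) * ennreal (w a r)"
      by (subst nn_integral_add) (auto simp: nn_integral_cmult_indicator emeasure_\<nu>_cube)
    finally have "ennreal (1 / w a r) * (\<integral>\<^sup>+y\<in>cube a r. ennreal (g y) \<partial>\<nu>) \<le>
        ennreal (1 / w a r) * ((\<integral>\<^sup>+y\<in>cube a r. ?h y \<partial>\<nu>) + ennreal (t / 2) * ennreal (w a r))"
      by (rule mult_left_mono) simp
    also have "\<dots> = ennreal (1 / w a r) * (\<integral>\<^sup>+y\<in>cube a r. ?h y \<partial>\<nu>) + ennreal (t / 2)"
      using w \<open>0 < t\<close> by (simp add: distrib_left ennreal_mult[symmetric])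
    finally have "indicator (cube a r) x * (ennreal (1 / w a r) * (\<integral>\<^sup>+y\<in>cube a r. ennreal (g y) \<partial>\<nu>)) \<le>
        indicator (cube a r) x * (ennreal (1 / w a r) * (\<integral>\<^sup>+y\<in>cube a r. ?h y \<partial>\<nu>)) + ennreal (t / 2)"
      by (auto split: split_indicator)
    also have "\<dots> \<le> (SUP (a, r)\<in>rat_cubes. indicator (cube a r) x *
        (ennreal (1 / w a r) * (\<integral>\<^sup>+y\<in>cube a r. ?h y \<partial>\<nu>))) + ennreal (t / 2)"
      using ar by (intro add_right_mono SUP_upper2[of "(a, r)"]) auto
    finally show "indicator (cube a r) x * (ennreal (1 / w a r) * (\<integral>\<^sup>+y\<in>cube a r. ennreal (g y) \<partial>\<nu>))
      \<le> (SUP (a, r)\<in>rat_cubes. indicator (cube a r) x *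
        (ennreal (1 / w a r) * (\<integral>\<^sup>+y\<in>cube a r. ?h y \<partial>\<nu>))) + ennreal (t / 2)" .
  qed
  have "{x. ennreal t < maximal (\<lambda>x. ennreal (g x)) x} \<subseteq> {x. ennreal (t / 2) < maximal ?h x}"
  proof (intro subsetI CollectI, rule ccontr)
    fix x
    assume "x \<in> {x. ennreal t < maximal (\<lambda>x. ennreal (g x)) x}" "\<not> ennreal (t / 2) < maximal ?h x"
    then have "ennreal t < maximal ?h x + ennreal (t / 2)" "maximal ?h x \<le> ennreal (t / 2)"
      using le[of x] by auto
    then have "ennreal t < ennreal (t / 2) + ennreal (t / 2)"
      by (meson add_right_mono less_le_trans)
    then show False using \<open>0 < t\<close> by (simp add: ennreal_plus[symmetric] del: ennreal_plus)
  qed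
  then have "emeasure \<nu> {x. ennreal t < maximal (\<lambda>x. ennreal (g x)) x} \<le>
      emeasure \<nu> {x. ennreal (t / 2) < maximal ?h x}"
  proof (rule emeasure_mono)
    have "{x \<in> space lebesgue. ennreal (t / 2) < maximal ?h x} \<in> sets lebesgue" by measurable
    then show "{x. ennreal (t / 2) < maximal ?h x} \<in> sets \<nu>" by simp
  qed
  also have "\<dots> = ennreal (2 / t) * (ennreal (t / 2) * emeasure \<nu> {x. ennreal (t / 2) < maximal ?h x})"
    using \<open>0 < t\<close> by (simp add: mult.assoc[symmetric] ennreal_mult[symmetric])
  also have "\<dots> \<le> ennreal (2 / t) * (ennreal (C * 3 ^ DIM('a)) * (\<integral>\<^sup>+x. ?h x \<partial>\<nu>))"
    by (intro mult_left_mono maximal_weak_type) auto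
  also have "\<dots> = ennreal (2 * C * 3 ^ DIM('a) / t) * (\<integral>\<^sup>+x. ?h x \<partial>\<nu>)"
    using \<open>0 < t\<close> C_ge_1 by (simp add: mult.assoc[symmetric] ennreal_mult[symmetric])
  finally show ?thesis .
qed

text \<open>The first factors, up to 3^n, come from the truncated weak-type bound,
  \<open>2 powr p\<close> from rounding up to the next dyadic level, and the last fraction from the
  geometric series over the levels below 2 g.\<close>

definition strong_const :: "real \<Rightarrow> real" where
  "strong_const p = 2 * C * 3 ^ DIM('a) * 2 powr p * (2 powr (p - 1) / (1 - 2 powr (1 - p)))"

lemma strong_const_pos: "1 < p \<Longrightarrow> 0 < strong_const p"
  using C_ge_1 powr_less_mono[of "1 - p" 0 2] by (simp add: strong_const_def)

text \<open>Marcinkiewicz interpolation in dyadic form: the truncated weak-type bound is applied at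
  every level 2^k, and the sum over levels is then carried out for each fixed x.\<close>

lemma maximal_strong_type:
  fixes g :: "'a \<Rightarrow> real"
  assumes g [measurable]: "g \<in> borel_measurable lebesgue" and g0: "\<And>x. 0 \<le> g x" and "1 < p"
  shows "(\<integral>\<^sup>+x. enn_powr (maximal (\<lambda>x. ennreal (g x)) x) p \<partial>\<nu>) \<le>
    ennreal (strong_const p) * (\<integral>\<^sup>+x. ennreal (g x powr p) \<partial>\<nu>)"
proof -
  let ?M = "maximal (\<lambda>x. ennreal (g x))" and ?N = "count_space (UNIV :: int set)"
  let ?D = "2 * C * 3 ^ DIM('a)"
  define c d :: "int \<Rightarrow> real" where "c k = 2 powr of_int k" and "d k = 2 powr ((of_int k + 1) * p)" for k
  define E where "E k = {x. ennreal (c k) < ?M x}" for k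
  have [measurable]: "E k \<in> sets lebesgue" for k
  proof -
    have "{x \<in> space lebesgue. ennreal (c k) < ?M x} \<in> sets lebesgue" by measurable
    then show ?thesis by (simp add: E_def)
  qed
  have c_pos: "0 < c k" for k by (simp add: c_def)
  have "(\<integral>\<^sup>+x. enn_powr (?M x) p \<partial>\<nu>) \<le> (\<integral>\<^sup>+x. \<integral>\<^sup>+k. ennreal (d k) * indicator (E k) x \<partial>?N \<partial>\<nu>)"
    using dyadic_powr_le[OF \<open>1 < p\<close>]
    by (intro nn_integral_mono) (simp only: indicator_def mem_Collect_eq c_def d_def E_def)
  also have "\<dots> = (\<integral>\<^sup>+k. \<integral>\<^sup>+x. ennreal (d k) * indicator (E k) x \<partial>\<nu> \<partial>?N)"
    by (intro nn_integral_count_space_nn_integral) auto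
  also have "\<dots> = (\<integral>\<^sup>+k. ennreal (d k) * emeasure \<nu> (E k) \<partial>?N)"
    by (rule nn_integral_cong, rule nn_integral_cmult_indicator) simp
  also have "\<dots> \<le> (\<integral>\<^sup>+k. ennreal (d k) * (ennreal (?D / c k) *
      (\<integral>\<^sup>+x. ennreal (g x) * indicator {x. c k / 2 < g x} x \<partial>\<nu>)) \<partial>?N)"
    unfolding E_def
    by (intro nn_integral_mono mult_left_mono maximal_weak_type_truncated g g0 c_pos) simp
  also have "\<dots> = (\<integral>\<^sup>+k. \<integral>\<^sup>+x. ennreal (d k) * (ennreal (?D / c k) *
      (ennreal (g x) * indicator {x. c k / 2 < g x} x)) \<partial>\<nu> \<partial>?N)"
    by (intro nn_integral_cong) (simp add: nn_integral_cmult)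
  also have "\<dots> = (\<integral>\<^sup>+x. \<integral>\<^sup>+k. ennreal (d k) * (ennreal (?D / c k) *
      (ennreal (g x) * indicator {x. c k / 2 < g x} x)) \<partial>?N \<partial>\<nu>)"
    by (intro nn_integral_count_space_nn_integral[symmetric]) auto
  also have "\<dots> \<le> (\<integral>\<^sup>+x. ennreal (strong_const p) * ennreal (g x powr p) \<partial>\<nu>)"
  proof (rule nn_integral_mono)
    fix x
    have dc: "d k * (?D / c k) = ?D * 2 powr p * 2 powr (of_int k * (p - 1))" for k
    proof -
      have "2 powr p * 2 powr (of_int k * (p - 1)) * c k = d k"
        unfolding c_def d_def by (simp add: powr_add[symmetric] algebra_simps)
      then show ?thesis using c_pos[of k] by (simp add: field_simps)
    qed
    have "ennreal (d k) * (ennreal (?D / c k) * (ennreal (g x) * indicator {x. c k / 2 < g x} x)) =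
      ennreal (?D * 2 powr p * g x) *
        (ennreal (2 powr (of_int k * (p - 1))) * indicator {k. c k < 2 * g x} k)" (is "?l = ?r") for k
    proof -
      have "0 \<le> d k" "0 \<le> ?D / c k" using C_ge_1 c_pos[of k] by (simp_all add: d_def)
      then have "ennreal (d k * (?D / c k) * g x) = ennreal (d k) * (ennreal (?D / c k) * ennreal (g x))"
        using g0[of x] by (simp only: ennreal_mult mult_nonneg_nonneg mult.assoc)
      then have "?l = ennreal (d k * (?D / c k) * g x) * indicator {k. c k < 2 * g x} k"
        by (auto simp: mult.assoc split: split_indicator)
      also have "\<dots> = ennreal (?D * 2 powr p * g x * 2 powr (of_int k * (p - 1))) * indicator {k. c k < 2 * g x} k"
        unfolding dc by (simp only: mult_ac)
      also have "\<dots> = ?r"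
        using C_ge_1 g0[of x] by (subst ennreal_mult) (simp_all add: mult.assoc)
      finally show ?thesis .
    qed
    then have "(\<integral>\<^sup>+k. ennreal (d k) * (ennreal (?D / c k) *
        (ennreal (g x) * indicator {x. c k / 2 < g x} x)) \<partial>?N) =
      (\<integral>\<^sup>+k. ennreal (?D * 2 powr p * g x) * (ennreal (2 powr (of_int k * (p - 1))) *
        indicator {k. c k < 2 * g x} k) \<partial>?N)"
      by (simp only:)
    also have "\<dots> = ennreal (?D * 2 powr p * g x) * (\<integral>\<^sup>+k. ennreal (2 powr (of_int k * (p - 1))) *
        indicator {k. c k < 2 * g x} k \<partial>?N)"
      by (rule nn_integral_cmult) simp
    also have "\<dots> \<le> ennreal (?D * 2 powr p * g x) * ennreal ((2 * g x) powr (p - 1) / (1 - 2 powr - (p - 1)))"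
      unfolding c_def using \<open>1 < p\<close> by (intro mult_left_mono dyadic_geometric_sum) simp_all
    also have "\<dots> = ennreal (?D * 2 powr p * g x * ((2 * g x) powr (p - 1) / (1 - 2 powr - (p - 1))))"
      using C_ge_1 g0[of x] \<open>1 < p\<close> 
      by (intro ennreal_mult[symmetric] mult_nonneg_nonneg divide_nonneg_nonneg) (use powr_less_mono[of "1 - p" 0 2] in auto)
    also have "?D * 2 powr p * g x * ((2 * g x) powr (p - 1) / (1 - 2 powr - (p - 1))) =
        strong_const p * g x powr p"
      using g0[of x] powr_mult_base[of "g x" "p - 1"]
      by (simp add: strong_const_def powr_mult field_simps)
    also have "ennreal \<dots> = ennreal (strong_const p) * ennreal (g x powr p)"
      using strong_const_pos[OF \<open>1 < p\<close>] by (intro ennreal_mult) auto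
    finally show "(\<integral>\<^sup>+k. ennreal (d k) * (ennreal (?D / c k) *
        (ennreal (g x) * indicator {x. c k / 2 < g x} x)) \<partial>?N) \<le>
        ennreal (strong_const p) * ennreal (g x powr p)" .
  qed
  also have "\<dots> = ennreal (strong_const p) * (\<integral>\<^sup>+x. ennreal (g x powr p) \<partial>\<nu>)"
    by (rule nn_integral_cmult) auto
  finally show ?thesis .
qed

end

subsection \<open>Necessity of the Lipschitz condition\<close>

text \<open>The cube itself is admissible in the supremum, and the mean of the distances from b(x)
  is at least the distance from b(x) to the mean.\<close>

lemma abs_diff_avg_le_max_comm:
  fixes b :: "'a::euclidean_space \<Rightarrow> real"
  assumes "locally_integrable b" "0 < r" "x \<in> cube a r"
  shows "ennreal \<bar>b x - avg b (cube a r)\<bar> \<le> max_comm b (indicator (cube a r)) x"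
proof -
  let ?Q = "cube a r"
  have "(\<integral>\<^sup>+y\<in>?Q. ennreal (\<bar>b x - b y\<bar> * \<bar>indicator ?Q y\<bar>) \<partial>lebesgue) =
      (\<integral>\<^sup>+y\<in>?Q. ennreal \<bar>b y - b x\<bar> \<partial>lebesgue)"
    by (intro nn_integral_cong) (auto split: split_indicator simp: abs_minus_commute)
  also have "\<dots> = ennreal (LINT y:?Q|lebesgue. \<bar>b y - b x\<bar>)"
    using assms by (intro set_nn_integral_eq_set_integral) auto
  finally have *: "ennreal (1 / measure lebesgue ?Q) * (\<integral>\<^sup>+y\<in>?Q. ennreal (\<bar>b x - b y\<bar> * \<bar>indicator ?Q y\<bar>) \<partial>lebesgue)
      = ennreal ((LINT y:?Q|lebesgue. \<bar>b y - b x\<bar>) / r ^ DIM('a))"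
    using assms by (simp add: measure_cube ennreal_mult'[symmetric])
  have "\<bar>b x - avg b ?Q\<bar> \<le> (LINT y:?Q|lebesgue. \<bar>b y - b x\<bar>) / r ^ DIM('a)"
    using abs_diff_avg_le[of b r a "b x"] assms by (simp add: field_simps abs_minus_commute)
  then show ?thesis
    unfolding max_comm_def using assms *
    by (intro SUP_upper2[of ?Q]) (auto intro: ennreal_leI)
qed

context A1_weight
begin

text \<open>Write the measure m of the intersection as m^\<kappa> m^(1-\<kappa>) and bound each
  factor by a different cube. The first factor cancels the Morrey normalisation when the norm of an
  indicator is computed.\<close>

lemma wmeas_Int_le:
  assumes "0 < \<kappa>" "\<kappa> < 1"
  shows "wmeas \<mu> (cube c s \<inter> cube a r) \<le> w c s powr \<kappa> * w a r powr (1 - \<kappa>)"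
proof -
  let ?m = "wmeas \<mu> (cube c s \<inter> cube a r)"
  have "?m = ?m powr \<kappa> * ?m powr (1 - \<kappa>)" by (simp add: powr_add[symmetric])
  also have "\<dots> \<le> w c s powr \<kappa> * w a r powr (1 - \<kappa>)"
    using assms wmeas_mono[of "cube c s \<inter> cube a r" "cube c s" c s]
      wmeas_mono[of "cube c s \<inter> cube a r" "cube a r" a r]
    by (intro mult_mono powr_mono2) auto
  finally show ?thesis .
qed

lemma morrey_norm_indicator:
  assumes "0 < \<kappa>" "\<kappa> < 1" "1 < p"
  shows "morrey_norm p \<kappa> \<mu> \<mu> (\<lambda>x. ennreal \<bar>indicator (cube a r) x\<bar>) \<le> ennreal (w a r powr ((1 - \<kappa>) / p))"
  unfolding morrey_norm_def
proof (rule SUP_least)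
  fix P :: "'a set" assume "P \<in> cubes"
  then obtain c s where cs: "0 < s" "P = cube c s" by (auto simp: cubes_iff)
  have "(\<integral>\<^sup>+x\<in>P. enn_powr (ennreal \<bar>indicator (cube a r) x\<bar>) p * ennreal (\<mu> x) \<partial>lebesgue)
      = (\<integral>\<^sup>+x. ennreal (\<mu> x) * indicator (P \<inter> cube a r) x \<partial>lebesgue)"
    by (intro nn_integral_cong) (auto split: split_indicator simp: enn_powr_def)
  also have "\<dots> = emeasure \<nu> (P \<inter> cube a r)"
    using cs by (simp add: \<nu>_def emeasure_density)
  also have "\<dots> = ennreal (wmeas \<mu> (P \<inter> cube a r))"
    using cs by (intro emeasure_\<nu>[of _ a r]) auto
  finally have "ennreal (1 / wmeas \<mu> P powr \<kappa>) *
      (\<integral>\<^sup>+x\<in>P. enn_powr (ennreal \<bar>indicator (cube a r) x\<bar>) p * ennreal (\<mu> x) \<partial>lebesgue)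
      = ennreal (wmeas \<mu> (P \<inter> cube a r) / wmeas \<mu> P powr \<kappa>)"
    by (simp add: ennreal_mult'[symmetric])
  also have "\<dots> \<le> ennreal (w a r powr (1 - \<kappa>))"
    using wmeas_Int_le[OF assms(1,2), of c s a r] w_pos[OF cs(1), of c] cs(2)
    by (intro ennreal_leI) (simp add: field_simps)
  finally have "enn_powr (ennreal (1 / wmeas \<mu> P powr \<kappa>) *
      (\<integral>\<^sup>+x\<in>P. enn_powr (ennreal \<bar>indicator (cube a r) x\<bar>) p * ennreal (\<mu> x) \<partial>lebesgue)) (1 / p)
      \<le> enn_powr (ennreal (w a r powr (1 - \<kappa>))) (1 / p)"
    using assms by (intro enn_powr_mono) auto
  also have "\<dots> = ennreal (w a r powr ((1 - \<kappa>) / p))"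
    by (simp add: enn_powr_ennreal powr_powr)
  finally show "enn_powr (ennreal (1 / wmeas \<mu> P powr \<kappa>) *
      (\<integral>\<^sup>+x\<in>P. enn_powr (ennreal \<bar>indicator (cube a r) x\<bar>) p * ennreal (\<mu> x) \<partial>lebesgue)) (1 / p)
      \<le> ennreal (w a r powr ((1 - \<kappa>) / p))" .
qed

lemma indicator_in_morrey_space:
  assumes "0 < \<kappa>" "\<kappa> < 1" "1 < p"
  shows "indicator (cube a r) \<in> morrey_space p \<kappa> \<mu> \<mu>"
  unfolding morrey_space_def mem_Collect_eq
proof (intro conjI allI impI)
  show "indicator (cube a r) \<in> borel_measurable lebesgue" by simp
  have "morrey_norm p \<kappa> \<mu> \<mu> (\<lambda>x. ennreal \<bar>indicator (cube a r) x\<bar>) < top"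
    by (rule le_less_trans[OF morrey_norm_indicator[OF assms]]) simp
  then show "morrey_norm p \<kappa> \<mu> \<mu> (\<lambda>x. ennreal \<bar>indicator (cube a r) x\<bar>) < \<infinity>"
    by simp
  fix K :: "'a set" assume "compact K"
  have "(\<integral>\<^sup>+x\<in>K. ennreal (\<bar>indicator (cube a r) x\<bar> powr p * \<mu> x) \<partial>lebesgue)
      \<le> (\<integral>\<^sup>+x. ennreal (\<mu> x) * indicator (cube a r) x \<partial>lebesgue)"
    by (intro nn_integral_mono) (auto split: split_indicator)
  also have "\<dots> = emeasure \<nu> (cube a r)"
    by (simp add: \<nu>_def emeasure_density)
  also have "\<dots> < \<infinity>" by (simp add: emeasure_\<nu>_cube)
  finally show "(\<integral>\<^sup>+x\<in>K. ennreal (\<bar>indicator (cube a r) x\<bar> powr p * \<mu> x) \<partial>lebesgue) < \<infinity>" .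
qed

text \<open>Applying \<open>le_add_powr\<close> with u = s \<mu>(x) produces exactly the weight
  \<open>\<mu> x powr (1 - q)\<close> of the target space. The parameter s is left free, to be
  balanced later.\<close>

lemma oscillation_le:
  assumes b: "locally_integrable b" and "0 < r" and "1 < q" "0 < s" "0 \<le> J"
    and J: "(\<integral>\<^sup>+x\<in>cube a r. enn_powr (max_comm b (indicator (cube a r)) x) q * ennreal (\<mu> x powr (1 - q)) \<partial>lebesgue) \<le> ennreal J"
  shows "(LINT x:cube a r|lebesgue. \<bar>b x - avg b (cube a r)\<bar>) \<le> s * w a r + s powr (1 - q) * J"
proof -
  let ?Q = "cube a r" and ?t = "\<lambda>x. \<bar>b x - avg b (cube a r)\<bar>"
  have [measurable]: "b \<in> borel_measurable lebesgue"
    by (rule locally_integrable_measurable[OF b])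
  have "ennreal (LINT x:?Q|lebesgue. ?t x) = (\<integral>\<^sup>+x\<in>?Q. ennreal (?t x) \<partial>lebesgue)"
    using b by (intro set_nn_integral_eq_set_integral[symmetric]) auto
  also have "\<dots> \<le> (\<integral>\<^sup>+x. ennreal s * (ennreal (\<mu> x) * indicator ?Q x) +
      ennreal (s powr (1 - q)) * (ennreal (?t x powr q * \<mu> x powr (1 - q)) * indicator ?Q x) \<partial>lebesgue)"
  proof (rule nn_integral_mono_AE, rule eventually_mono[OF AE_pos])
    fix x assume "0 < \<mu> x"
    then have "?t x \<le> s * \<mu> x + ?t x powr q * (s * \<mu> x) powr (1 - q)"
      using assms by (intro le_add_powr) auto
    also have "\<dots> = s * \<mu> x + s powr (1 - q) * (?t x powr q * \<mu> x powr (1 - q))"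
      using assms by (simp add: powr_mult)
    finally have "ennreal (?t x) \<le> ennreal (s * \<mu> x + s powr (1 - q) * (?t x powr q * \<mu> x powr (1 - q)))"
      by (rule ennreal_leI)
    also have "\<dots> = ennreal s * ennreal (\<mu> x) + ennreal (s powr (1 - q)) * ennreal (?t x powr q * \<mu> x powr (1 - q))"
      using assms by (simp add: ennreal_mult[symmetric])
    finally show "ennreal (?t x) * indicator ?Q x \<le> ennreal s * (ennreal (\<mu> x) * indicator ?Q x) +
      ennreal (s powr (1 - q)) * (ennreal (?t x powr q * \<mu> x powr (1 - q)) * indicator ?Q x)"
      by (auto split: split_indicator)
  qed
  also have "\<dots> = ennreal s * (\<integral>\<^sup>+x. ennreal (\<mu> x) * indicator ?Q x \<partial>lebesgue) +
      ennreal (s powr (1 - q)) * (\<integral>\<^sup>+x\<in>?Q. ennreal (?t x powr q * \<mu> x powr (1 - q)) \<partial>lebesgue)"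
    by (simp add: nn_integral_add nn_integral_cmult)
  also have "(\<integral>\<^sup>+x. ennreal (\<mu> x) * indicator ?Q x \<partial>lebesgue) = ennreal (w a r)"
    using emeasure_\<nu>_cube[of a r] by (simp add: \<nu>_def emeasure_density)
  also have "(\<integral>\<^sup>+x\<in>?Q. ennreal (?t x powr q * \<mu> x powr (1 - q)) \<partial>lebesgue) \<le>
      (\<integral>\<^sup>+x\<in>?Q. enn_powr (max_comm b (indicator ?Q) x) q * ennreal (\<mu> x powr (1 - q)) \<partial>lebesgue)"
  proof (rule nn_integral_mono)
    fix x
    have "ennreal (?t x powr q) \<le> enn_powr (max_comm b (indicator ?Q) x) q" if "x \<in> ?Q"
      using enn_powr_mono[OF abs_diff_avg_le_max_comm[OF b \<open>0 < r\<close> that], of q] \<open>1 < q\<close>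
      by (simp add: enn_powr_ennreal)
    then show "ennreal (?t x powr q * \<mu> x powr (1 - q)) * indicator ?Q x \<le>
        enn_powr (max_comm b (indicator ?Q) x) q * ennreal (\<mu> x powr (1 - q)) * indicator ?Q x"
      by (auto simp: ennreal_mult intro!: mult_right_mono split: split_indicator)
  qed
  also note J
  finally have "ennreal (LINT x:?Q|lebesgue. ?t x) \<le> ennreal s * ennreal (w a r) + ennreal (s powr (1 - q)) * ennreal J"
    by (simp add: mult_left_mono add_left_mono)
  also have "\<dots> = ennreal (s * w a r + s powr (1 - q) * J)"
    using assms by (simp add: ennreal_mult[symmetric])
  finally show ?thesis
    using assms by (subst (asm) ennreal_le_iff) auto
qed

lemma Lip_if_max_comm_bounded:
  assumes b: "locally_integrable b" and \<beta>: "0 < \<beta>" and p: "1 < p" and q: "1 < q"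
    and pq: "1 / q = 1 / p - \<beta> / real DIM('a)" and \<kappa>: "0 < \<kappa>" "\<kappa> < 1" and "0 < K"
    and bounded: "\<And>f. f \<in> morrey_space p \<kappa> \<mu> \<mu> \<Longrightarrow>
      morrey_norm q (\<kappa> * q / p) (\<lambda>x. \<mu> x powr (1 - q)) \<mu> (max_comm b f)
        \<le> ennreal K * morrey_norm p \<kappa> \<mu> \<mu> (\<lambda>x. ennreal \<bar>f x\<bar>)"
  shows "b \<in> Lip_w \<beta> \<mu>"
  unfolding Lip_w_def mem_Collect_eq
proof (intro conjI exI ballI)
  let ?n = "real DIM('a)"
  fix Q :: "'a set" assume "Q \<in> cubes"
  then obtain a r where ar: "0 < r" "Q = cube a r" by (auto simp: cubes_iff)
  define W where "W = w a r"
  have W: "0 < W" unfolding W_def by (rule w_pos) fact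
  let ?I = "\<integral>\<^sup>+x\<in>Q. enn_powr (max_comm b (indicator Q) x) q * ennreal (\<mu> x powr (1 - q)) \<partial>lebesgue"
  have "enn_powr (ennreal (1 / W powr (\<kappa> * q / p)) * ?I) (1 / q) \<le>
      morrey_norm q (\<kappa> * q / p) (\<lambda>x. \<mu> x powr (1 - q)) \<mu> (max_comm b (indicator Q))"
    unfolding morrey_norm_def using ar by (intro SUP_upper2[of Q]) (auto simp: W_def)
  also have "\<dots> \<le> ennreal K * morrey_norm p \<kappa> \<mu> \<mu> (\<lambda>x. ennreal \<bar>indicator Q x\<bar>)"
    unfolding ar(2) by (rule bounded[OF indicator_in_morrey_space[OF \<kappa> p]])
  also have "\<dots> \<le> ennreal K * ennreal (W powr ((1 - \<kappa>) / p))"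
    unfolding ar(2) W_def by (intro mult_left_mono morrey_norm_indicator \<kappa> p) simp
  also have "\<dots> = ennreal (K * W powr ((1 - \<kappa>) / p))"
    using \<open>0 < K\<close> by (simp add: ennreal_mult)
  finally have "ennreal (1 / W powr (\<kappa> * q / p)) * ?I \<le> ennreal ((K * W powr ((1 - \<kappa>) / p)) powr (1 / (1 / q)))"
    using q \<open>0 < K\<close> by (intro enn_powr_le_imp_le) auto
  then have "ennreal (W powr (\<kappa> * q / p)) * (ennreal (1 / W powr (\<kappa> * q / p)) * ?I) \<le>
      ennreal (W powr (\<kappa> * q / p)) * ennreal ((K * W powr ((1 - \<kappa>) / p)) powr (1 / (1 / q)))"
    by (rule mult_left_mono) simp
  also have "ennreal (W powr (\<kappa> * q / p)) * (ennreal (1 / W powr (\<kappa> * q / p)) * ?I) = ?I"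
    using W by (simp add: mult.assoc[symmetric] ennreal_mult[symmetric])
  \<comment> \<open>The exponents \<kappa> q / p and (1 - \<kappa>) q / p add up to q / p, so
    \<kappa> disappears.\<close>
  also have "ennreal (W powr (\<kappa> * q / p)) * ennreal ((K * W powr ((1 - \<kappa>) / p)) powr (1 / (1 / q))) =
      ennreal (K powr q * W powr (q / p))"
    using \<open>0 < K\<close> W p q
    by (simp add: ennreal_mult[symmetric] powr_mult powr_powr powr_add[symmetric] field_simps)
  \<comment> \<open>The choice s = W^(\<beta>/n) makes the first term the desired power W^(1 +
    \<beta>/n); the relation between p and q gives the second term the same exponent.\<close>
  finally have "(LINT x:Q|lebesgue. \<bar>b x - avg b Q\<bar>) \<le>
      W powr (\<beta> / ?n) * W + (W powr (\<beta> / ?n)) powr (1 - q) * (K powr q * W powr (q / p))"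
    unfolding ar(2) W_def using b q ar W by (intro oscillation_le) (auto simp: W_def)
  also have "(W powr (\<beta> / ?n)) powr (1 - q) * (K powr q * W powr (q / p)) =
      K powr q * W powr ((\<beta> / ?n) * (1 - q) + q / p)"
    by (simp add: powr_powr powr_add)
  also have "(\<beta> / ?n) * (1 - q) + q / p = \<beta> / ?n + q * (1 / p - \<beta> / ?n)"
    by (simp add: algebra_simps diff_divide_distrib)
  also have "\<dots> = \<beta> / ?n + 1"
    unfolding pq[symmetric] using q by simp
  also have "W powr (\<beta> / ?n + 1) = W powr (\<beta> / ?n) * W"
    using W by (simp add: powr_add)
  finally have "(LINT x:Q|lebesgue. \<bar>b x - avg b Q\<bar>) \<le> (1 + K powr q) * (W powr (\<beta> / ?n) * W)"
    by (simp add: algebra_simps)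
  then show "1 / wmeas \<mu> Q powr (\<beta> / ?n) * (1 / wmeas \<mu> Q) * (LINT x:Q|lebesgue. \<bar>b x - avg b Q\<bar>) \<le> 1 + K powr q"
    using W unfolding ar(2) W_def[symmetric] by (simp add: field_simps)
qed (rule b)

end

subsection \<open>Pointwise oscillation of weighted Lipschitz functions\<close>

text \<open>Lebesgue differentiation along cubes having x as lower corner, which is why cubes are
  described by a corner. The null set is independent of the initial side r.\<close>

lemma AE_avg_cube_tendsto:
  fixes f :: "'a::euclidean_space \<Rightarrow> real"
  assumes f: "locally_integrable f"
  shows "AE x in lebesgue. \<forall>r>0. (\<lambda>k. avg f (cube x (r / 2 ^ k))) \<longlonglongrightarrow> f x"
proof -
  have "f integrable_on cbox a b" for a b
    using f set_lebesgue_integral_eq_integral(1)[of "cbox a b" f] by (simp add: locally_integrable_def)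
  then obtain N where N: "negligible N" and
    lim: "\<And>x e. \<lbrakk>x \<notin> N; 0 < e\<rbrakk> \<Longrightarrow> \<exists>d>0. \<forall>h. 0 < h \<and> h < d \<longrightarrow>
      norm (integral (cbox x (x + h *\<^sub>R One)) f /\<^sub>R h ^ DIM('a) - f x) < e"
    using integrable_ccontinuous_explicit by blast
  show ?thesis
  proof (rule AE_I')
    show "N \<in> null_sets lebesgue" using N by (simp add: negligible_iff_null_sets)
    show "{x \<in> space lebesgue. \<not> (\<forall>r>0. (\<lambda>k. avg f (cube x (r / 2 ^ k))) \<longlonglongrightarrow> f x)} \<subseteq> N"
    proof (clarify, rule ccontr)
      fix x r assume "(0::real) < r" "x \<notin> N"
      have "(\<lambda>k. avg f (cube x (r / 2 ^ k))) \<longlonglongrightarrow> f x"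
      proof (rule metric_LIMSEQ_I)
        fix e :: real assume "0 < e"
        from lim[OF \<open>x \<notin> N\<close> this] obtain d where d: "d > 0" "\<And>h. 0 < h \<Longrightarrow> h < d \<Longrightarrow>
            norm (integral (cbox x (x + h *\<^sub>R One)) f /\<^sub>R h ^ DIM('a) - f x) < e" by blast
        have "(\<lambda>k. r / 2 ^ k) \<longlonglongrightarrow> 0" using LIMSEQ_divide_realpow_zero[of 2 r] by simp
        then obtain n0 where n0: "\<And>k. k \<ge> n0 \<Longrightarrow> r / 2 ^ k < d"
          using order_tendstoD(2)[of "\<lambda>k. r / 2 ^ k" 0 sequentially d] d(1)
          unfolding eventually_sequentially by blast
        have "dist (avg f (cube x (r / 2 ^ k))) (f x) < e" if "k \<ge> n0" for k
        proof -
          let ?h = "r / 2 ^ k"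
          have "avg f (cube x ?h) = integral (cbox x (x + ?h *\<^sub>R One)) f /\<^sub>R ?h ^ DIM('a)"
            using \<open>0 < r\<close> set_lebesgue_integral_eq_integral(2)[OF set_integrable_cube[OF f, of x ?h]]
              measure_cube[of ?h x]
            unfolding avg_def by (simp add: cube_def divide_inverse_commute)
          then show ?thesis using d(2)[of ?h] n0[OF that] \<open>0 < r\<close> by (simp add: dist_norm)
        qed
        then show "\<exists>n0. \<forall>k\<ge>n0. dist (avg f (cube x (r / 2 ^ k))) (f x) < e" by blast
      qed
      moreover assume "\<not> (\<lambda>k. avg f (cube x (r / 2 ^ k))) \<longlonglongrightarrow> f x"
      ultimately show False by contradiction
    qed
  qed
qed

context A1_weight
begin

lemma w_dyadic: "0 < r \<Longrightarrow> w x (r / 2 ^ k) \<le> \<delta> ^ k * w x r"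
proof (induction k)
  case (Suc k)
  have "w x (r / 2 ^ Suc k) = w x (r / 2 ^ k / 2)" by (simp add: mult.commute)
  also have "\<dots> \<le> \<delta> * w x (r / 2 ^ k)" using Suc.prems by (intro w_half) simp
  also have "\<dots> \<le> \<delta> * (\<delta> ^ k * w x r)" using Suc delta by (intro mult_left_mono) auto
  finally show ?case by simp
qed simp

text \<open>The oscillation bound has the power 1 + \<alpha> of the weighted measure. One full power
  is traded, by A1 at x, for r^n \<mu>(x); the volume cancels against that of the inner cube,
  leaving 2^n from r \<le> 2s.\<close>

lemma avg_diff_nested:
  assumes b: "locally_integrable b"
    and osc: "(LINT y:cube a r|lebesgue. \<bar>b y - avg b (cube a r)\<bar>) \<le> B * w a r powr (1 + \<alpha>)"
    and "0 \<le> B" and le: "w a r \<le> A * r ^ DIM('a) * \<mu> x"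
    and sub: "cube c s \<subseteq> cube a r" and "0 < s" "r \<le> 2 * s" "0 < r" "0 \<le> A"
  shows "\<bar>avg b (cube c s) - avg b (cube a r)\<bar> \<le> 2 ^ DIM('a) * B * A * w a r powr \<alpha> * \<mu> x"
proof -
  let ?m = "avg b (cube a r)"
  have "\<bar>avg b (cube c s) - ?m\<bar> * s ^ DIM('a) \<le> (LINT y:cube c s|lebesgue. \<bar>b y - ?m\<bar>)"
    using b \<open>0 < s\<close> by (rule abs_diff_avg_le)
  also have "\<dots> \<le> (LINT y:cube a r|lebesgue. \<bar>b y - ?m\<bar>)"
    unfolding set_lebesgue_integral_def
    using set_integrable_abs_diff_cube[OF b] sub
    by (intro integral_mono) (auto simp: set_integrable_def split: split_indicator)
  also note osc
  also have "B * w a r powr (1 + \<alpha>) = B * w a r powr \<alpha> * w a r"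
    by (simp add: powr_add)
  also have "\<dots> \<le> B * w a r powr \<alpha> * (A * (2 * s) ^ DIM('a) * \<mu> x)"
  proof (rule mult_left_mono)
    have "A * r ^ DIM('a) * \<mu> x \<le> A * (2 * s) ^ DIM('a) * \<mu> x"
      using assms by (intro mult_right_mono mult_left_mono power_mono) auto
    with le show "w a r \<le> A * (2 * s) ^ DIM('a) * \<mu> x" by linarith
  qed (use \<open>0 \<le> B\<close> in simp)
  also have "\<dots> = 2 ^ DIM('a) * B * A * w a r powr \<alpha> * \<mu> x * s ^ DIM('a)"
    by (simp add: power_mult_distrib)
  finally show ?thesis
    using \<open>0 < s\<close> by (subst (asm) mult_le_cancel_right_pos) auto
qed

lemma AE_abs_diff_avg_le:
  assumes b: "locally_integrable b" and "0 \<le> B" and "0 < \<alpha>"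
    and osc: "\<And>a r. 0 < r \<Longrightarrow>
      (LINT y:cube a r|lebesgue. \<bar>b y - avg b (cube a r)\<bar>) \<le> B * w a r powr (1 + \<alpha>)"
  shows "\<exists>K>0. AE x in lebesgue. \<forall>a r. 0 < r \<longrightarrow> x \<in> cube a r \<longrightarrow>
    \<bar>b x - avg b (cube a r)\<bar> \<le> K * w a r powr \<alpha> * \<mu> x"
proof -
  define A where "A = C * 2 ^ DIM('a)"
  define D where "D = 2 ^ DIM('a) * B * A"
  define \<eta> where "\<eta> = \<delta> powr \<alpha>"
  \<comment> \<open>Two comparisons with the doubled cube give the 2, the telescoping series gives
    1/(1 - \<eta>), and the power of A returns from the doubled cube to the original one.\<close>
  define K where "K = D * (2 + 1 / (1 - \<eta>)) * A powr \<alpha>"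
  have A: "0 < A" using C_ge_1 by (simp add: A_def)
  have D: "0 \<le> D" using A \<open>0 \<le> B\<close> by (simp add: D_def)
  have \<eta>: "0 < \<eta>" "\<eta> < 1"
    using delta powr_less_mono2[of \<alpha> \<delta> 1] \<open>0 < \<alpha>\<close> by (auto simp: \<eta>_def)
  have K: "0 \<le> K" using D \<eta> by (simp add: K_def)
  have "AE x in lebesgue. \<forall>a r. 0 < r \<longrightarrow> x \<in> cube a r \<longrightarrow>
    \<bar>b x - avg b (cube a r)\<bar> \<le> K * w a r powr \<alpha> * \<mu> x"
    using AE_avg_cube_tendsto[OF b] AE_w_le
  proof eventually_elim
    case (elim x)
    then have le: "w a r \<le> A * r ^ DIM('a) * \<mu> x" if "0 < r" "x \<in> cube a r" for a r
      using that by (simp add: A_def)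
    have nested: "\<bar>avg b (cube c s) - avg b (cube a r)\<bar> \<le> D * w a r powr \<alpha> * \<mu> x"
      if "0 < s" "r \<le> 2 * s" "0 < r" "x \<in> cube a r" "cube c s \<subseteq> cube a r" for a r c s
      unfolding D_def
      using that A by (intro avg_diff_nested[OF b osc \<open>0 \<le> B\<close> le]) auto
    show ?case
    proof (intro allI impI)
      fix a r assume r: "0 < r" and x: "x \<in> cube a r"
      have sub: "cube a r \<subseteq> cube a (2 * r)" using r by (intro cube_mono) simp
      \<comment> \<open>The point x is in general not the corner of the given cube. The doubled cube
        contains both that cube and the cube with corner x, so their averages are compared through
        it.\<close>
      have sub': "cube x r \<subseteq> cube a (2 * r)" using cube_subset_double[OF x] r by simp
      define V where "V = w a (2 * r) powr \<alpha> * \<mu> x"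
      have 1: "\<bar>avg b (cube a r) - avg b (cube a (2 * r))\<bar> \<le> D * V"
        using nested[of r "2 * r" a a] r x sub by (auto simp: V_def mult.assoc)
      have 2: "\<bar>avg b (cube x r) - avg b (cube a (2 * r))\<bar> \<le> D * V"
        using nested[of r "2 * r" a x] r x sub sub' by (auto simp: V_def mult.assoc)
      \<comment> \<open>Reverse doubling supplies the decay \<delta>^k; raised to the power \<alpha>
        it is the ratio \<eta> of the series.\<close>
      have step: "\<bar>avg b (cube x (r / 2 ^ Suc k)) - avg b (cube x (r / 2 ^ k))\<bar> \<le> D * V * \<eta> ^ k" for k
      proof -
        have "\<bar>avg b (cube x (r / 2 ^ Suc k)) - avg b (cube x (r / 2 ^ k))\<bar> \<le> D * w x (r / 2 ^ k) powr \<alpha> * \<mu> x"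
          using r by (intro nested cube_mono corner_in_cube) (auto simp: field_simps)
        also have "w x (r / 2 ^ k) powr \<alpha> \<le> (\<delta> ^ k * w a (2 * r)) powr \<alpha>"
        proof (rule powr_mono2)
          have "w x (r / 2 ^ k) \<le> \<delta> ^ k * w x r" using r by (rule w_dyadic)
          also have "\<dots> \<le> \<delta> ^ k * w a (2 * r)" using delta w_mono[OF sub'] by (intro mult_left_mono) auto
          finally show "w x (r / 2 ^ k) \<le> \<delta> ^ k * w a (2 * r)" .
        qed (use \<open>0 < \<alpha>\<close> in auto)
        also have "\<dots> = \<eta> ^ k * w a (2 * r) powr \<alpha>"
          using delta by (simp add: \<eta>_def powr_mult powr_realpow[symmetric] powr_powr mult.commute)
        finally show ?thesis using D by (simp add: V_def mult_left_mono mult_right_mono mult_ac)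
      qed
      have sum: "\<bar>avg b (cube x (r / 2 ^ m)) - avg b (cube x r)\<bar> \<le> D * V * (1 / (1 - \<eta>))" for m
      proof -
        have "avg b (cube x (r / 2 ^ m)) - avg b (cube x r) =
            (\<Sum>k<m. avg b (cube x (r / 2 ^ Suc k)) - avg b (cube x (r / 2 ^ k)))"
          by (subst sum_lessThan_telescope) simp
        also have "\<bar>\<dots>\<bar> \<le> (\<Sum>k<m. D * V * \<eta> ^ k)"
          by (rule order_trans[OF sum_abs sum_mono[OF step]])
        also have "\<dots> = D * V * (\<Sum>k<m. \<eta> ^ k)" by (simp add: sum_distrib_left)
        also have "(\<Sum>k<m. \<eta> ^ k) \<le> 1 / (1 - \<eta>)"
          using \<eta> by (subst sum_gp_strict) (auto simp: divide_right_mono)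
        finally show ?thesis using D by (simp add: V_def mult_left_mono)
      qed
      have "(\<lambda>m. \<bar>avg b (cube x (r / 2 ^ m)) - avg b (cube x r)\<bar>) \<longlonglongrightarrow> \<bar>b x - avg b (cube x r)\<bar>"
        using elim(1) r by (intro tendsto_intros) auto
      then have 3: "\<bar>b x - avg b (cube x r)\<bar> \<le> D * V * (1 / (1 - \<eta>))"
        by (rule LIMSEQ_le_const2) (use sum in blast)
      have "\<bar>b x - avg b (cube a r)\<bar> \<le> D * V * (1 / (1 - \<eta>)) + D * V + D * V"
        using 1 2 3 by linarith
      also have "\<dots> = D * (2 + 1 / (1 - \<eta>)) * \<mu> x * w a (2 * r) powr \<alpha>"
        by (simp add: V_def algebra_simps)
      also have "\<dots> \<le> D * (2 + 1 / (1 - \<eta>)) * \<mu> x * (A * w a r) powr \<alpha>"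
        using D \<eta> \<open>0 < \<alpha>\<close> w_doubling[OF sub, of 2] r
        by (intro mult_left_mono powr_mono2) (auto simp: A_def)
      also have "\<dots> = K * w a r powr \<alpha> * \<mu> x"
        using A by (simp add: K_def powr_mult mult_ac)
      finally show "\<bar>b x - avg b (cube a r)\<bar> \<le> K * w a r powr \<alpha> * \<mu> x" .
    qed
  qed
  \<comment> \<open>K vanishes when B = 0; adding 1 provides a strictly positive constant.\<close>
  then have "AE x in lebesgue. \<forall>a r. 0 < r \<longrightarrow> x \<in> cube a r \<longrightarrow>
    \<bar>b x - avg b (cube a r)\<bar> \<le> (K + 1) * w a r powr \<alpha> * \<mu> x"
  proof (rule eventually_mono, intro allI impI)
    fix x a r assume "\<forall>a r. 0 < r \<longrightarrow> x \<in> cube a r \<longrightarrow>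
      \<bar>b x - avg b (cube a r)\<bar> \<le> K * w a r powr \<alpha> * \<mu> x" "0 < r" "x \<in> cube a r"
    then have "\<bar>b x - avg b (cube a r)\<bar> \<le> K * w a r powr \<alpha> * \<mu> x" by blast
    also have "\<dots> \<le> (K + 1) * w a r powr \<alpha> * \<mu> x" by (intro mult_right_mono) auto
    finally show "\<bar>b x - avg b (cube a r)\<bar> \<le> (K + 1) * w a r powr \<alpha> * \<mu> x" .
  qed
  then show ?thesis using K by (intro exI[of _ "K + 1"]) auto
qed

subsection \<open>Boundedness of the maximal commutator\<close>

text \<open>The triangle inequality through the average of b yields the sum \<mu>(x) + \<mu>(y).
  Turning it into a multiple of the product separates the variables: \<mu>(x) leaves the integral
  and \<mu>(y) dy becomes integration against \<nu>.\<close>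

lemma max_comm_le:
  assumes K: "0 < K" and f [measurable]: "f \<in> borel_measurable lebesgue"
    and Lip: "AE y in lebesgue. \<forall>a r. 0 < r \<longrightarrow> y \<in> cube a r \<longrightarrow>
      \<bar>b y - avg b (cube a r)\<bar> \<le> K * w a r powr \<alpha> * \<mu> y"
    and x: "\<forall>a r. 0 < r \<longrightarrow> x \<in> cube a r \<longrightarrow> \<bar>b x - avg b (cube a r)\<bar> \<le> K * w a r powr \<alpha> * \<mu> x"
    and wx: "\<forall>a r. 0 < r \<longrightarrow> x \<in> cube a r \<longrightarrow> w a r \<le> C * 2 ^ DIM('a) * r ^ DIM('a) * \<mu> x"
    and s: "0 < s" and xP: "x \<in> cube c s"
  shows "ennreal (1 / measure lebesgue (cube c s)) * (\<integral>\<^sup>+y\<in>cube c s. ennreal (\<bar>b x - b y\<bar> * \<bar>f y\<bar>) \<partial>lebesgue)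
    \<le> ennreal (2 * K * C * 2 ^ DIM('a) * \<mu> x) * (ennreal (w c s powr (\<alpha> - 1)) * (\<integral>\<^sup>+y\<in>cube c s. ennreal \<bar>f y\<bar> \<partial>\<nu>))"
proof -
  define W where "W = w c s"
  define M where "M = C * 2 ^ DIM('a) * s ^ DIM('a)"
  have W: "0 < W" unfolding W_def using s by (rule w_pos)
  have M: "0 < M" using C_ge_1 s by (simp add: M_def)
  have "AE y in lebesgue. ennreal (\<bar>b x - b y\<bar> * \<bar>f y\<bar>) * indicator (cube c s) y \<le>
      ennreal (2 * K * M * \<mu> x * W powr (\<alpha> - 1)) * (ennreal (\<mu> y) * (ennreal \<bar>f y\<bar> * indicator (cube c s) y))"
    using Lip AE_w_le
  proof eventually_elim
    case (elim y)
    show ?case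
    proof (cases "y \<in> cube c s")
      case True
      have wy: "W \<le> M * \<mu> y" and wx': "W \<le> M * \<mu> x"
        using elim(2) wx s True xP by (auto simp: W_def M_def)
      \<comment> \<open>A1 bounds W by M \<mu>(x) and by M \<mu>(y); multiplying each bound by the
        other weight value and adding converts sum into product. The factor s^n in M later cancels
        the volume of the cube.\<close>
      have "\<mu> x * W \<le> \<mu> x * (M * \<mu> y)" "\<mu> y * W \<le> \<mu> y * (M * \<mu> x)"
        using wy wx' by (intro mult_left_mono; simp)+
      then have sum: "\<mu> x + \<mu> y \<le> 2 * M * \<mu> x * \<mu> y / W"
        using W by (simp add: field_simps)
      have "\<bar>b x - b y\<bar> \<le> \<bar>b x - avg b (cube c s)\<bar> + \<bar>b y - avg b (cube c s)\<bar>" by linarith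
      also have "\<dots> \<le> K * W powr \<alpha> * \<mu> x + K * W powr \<alpha> * \<mu> y"
        using x elim(1) s xP True by (intro add_mono) (auto simp: W_def)
      also have "\<dots> = K * W powr \<alpha> * (\<mu> x + \<mu> y)" by (simp add: algebra_simps)
      also have "\<dots> \<le> K * W powr \<alpha> * (2 * M * \<mu> x * \<mu> y / W)"
        using sum K by (intro mult_left_mono) auto
      also have "\<dots> = 2 * K * M * \<mu> x * W powr (\<alpha> - 1) * \<mu> y"
        using W by (simp add: powr_diff)
      finally have "\<bar>b x - b y\<bar> * \<bar>f y\<bar> \<le> 2 * K * M * \<mu> x * W powr (\<alpha> - 1) * (\<mu> y * \<bar>f y\<bar>)"
        by (simp add: mult.assoc[symmetric] mult_right_mono)
      then have "ennreal (\<bar>b x - b y\<bar> * \<bar>f y\<bar>) \<le> ennreal (2 * K * M * \<mu> x * W powr (\<alpha> - 1) * (\<mu> y * \<bar>f y\<bar>))"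
        by (rule ennreal_leI)
      also have "\<dots> = ennreal (2 * K * M * \<mu> x * W powr (\<alpha> - 1)) * (ennreal (\<mu> y) * ennreal \<bar>f y\<bar>)"
        using K M by (simp add: ennreal_mult)
      finally show ?thesis using True by simp
    qed simp
  qed
  then have "(\<integral>\<^sup>+y\<in>cube c s. ennreal (\<bar>b x - b y\<bar> * \<bar>f y\<bar>) \<partial>lebesgue) \<le>
      (\<integral>\<^sup>+y. ennreal (2 * K * M * \<mu> x * W powr (\<alpha> - 1)) * (ennreal (\<mu> y) * (ennreal \<bar>f y\<bar> * indicator (cube c s) y)) \<partial>lebesgue)"
    by (rule nn_integral_mono_AE)
  also have "\<dots> = ennreal (2 * K * M * \<mu> x * W powr (\<alpha> - 1)) * (\<integral>\<^sup>+y\<in>cube c s. ennreal \<bar>f y\<bar> \<partial>\<nu>)"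
    by (subst nn_integral_cmult) (auto simp: nn_integral_\<nu>)
  finally have "ennreal (1 / measure lebesgue (cube c s)) * (\<integral>\<^sup>+y\<in>cube c s. ennreal (\<bar>b x - b y\<bar> * \<bar>f y\<bar>) \<partial>lebesgue)
    \<le> ennreal (1 / measure lebesgue (cube c s)) * (ennreal (2 * K * M * \<mu> x * W powr (\<alpha> - 1)) * (\<integral>\<^sup>+y\<in>cube c s. ennreal \<bar>f y\<bar> \<partial>\<nu>))"
    by (rule mult_left_mono) simp
  also have "\<dots> = ennreal (1 / s ^ DIM('a) * (2 * K * M * \<mu> x * W powr (\<alpha> - 1))) * (\<integral>\<^sup>+y\<in>cube c s. ennreal \<bar>f y\<bar> \<partial>\<nu>)"
    using K M s by (subst ennreal_mult) (auto simp: measure_cube mult.assoc)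
  also have "1 / s ^ DIM('a) * (2 * K * M * \<mu> x * W powr (\<alpha> - 1)) = 2 * K * C * 2 ^ DIM('a) * \<mu> x * W powr (\<alpha> - 1)"
    using s by (simp add: M_def)
  also have "ennreal \<dots> = ennreal (2 * K * C * 2 ^ DIM('a) * \<mu> x) * ennreal (W powr (\<alpha> - 1))"
    using K C_ge_1 by (intro ennreal_mult) auto
  finally show ?thesis by (simp add: W_def mult.assoc)
qed

text \<open>Hoelder's inequality up to the factor 2, from the pointwise bound \<open>t \<le> u + t\<^sup>p u\<^sup>1\<^sup>-\<^sup>p\<close>.\<close>
lemma nn_integral_le_powr:
  assumes [measurable]: "f \<in> borel_measurable lebesgue" and "0 < s" "1 < p" "0 < J"
    and J: "(\<integral>\<^sup>+y\<in>cube c s. ennreal (\<bar>f y\<bar> powr p) \<partial>\<nu>) \<le> ennreal J"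
  shows "(\<integral>\<^sup>+y\<in>cube c s. ennreal \<bar>f y\<bar> \<partial>\<nu>) \<le> ennreal (2 * w c s powr (1 - 1 / p) * J powr (1 / p))"
proof -
  define W where "W = w c s"
  \<comment> \<open>This value makes the two integrated terms equal, hence the factor 2.\<close>
  define u where "u = (J / W) powr (1 / p)"
  have W: "0 < W" unfolding W_def using \<open>0 < s\<close> by (rule w_pos)
  have u: "0 < u" using W \<open>0 < J\<close> by (simp add: u_def)
  have "(\<integral>\<^sup>+y\<in>cube c s. ennreal \<bar>f y\<bar> \<partial>\<nu>) \<le>
      (\<integral>\<^sup>+y. ennreal u * indicator (cube c s) y + ennreal (u powr (1 - p)) * (ennreal (\<bar>f y\<bar> powr p) * indicator (cube c s) y) \<partial>\<nu>)"
  proof (rule nn_integral_mono)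
    fix y
    have "\<bar>f y\<bar> \<le> u + u powr (1 - p) * \<bar>f y\<bar> powr p"
      using le_add_powr[of "\<bar>f y\<bar>" u p] u \<open>1 < p\<close> by (simp add: mult.commute)
    then have "ennreal \<bar>f y\<bar> \<le> ennreal u + ennreal (u powr (1 - p)) * ennreal (\<bar>f y\<bar> powr p)"
      using u by (simp add: ennreal_leI flip: ennreal_mult ennreal_plus)
    then show "ennreal \<bar>f y\<bar> * indicator (cube c s) y \<le> ennreal u * indicator (cube c s) y +
        ennreal (u powr (1 - p)) * (ennreal (\<bar>f y\<bar> powr p) * indicator (cube c s) y)"
      by (auto split: split_indicator)
  qed
  also have "\<dots> = ennreal u * ennreal W + ennreal (u powr (1 - p)) * (\<integral>\<^sup>+y\<in>cube c s. ennreal (\<bar>f y\<bar> powr p) \<partial>\<nu>)"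
    by (subst nn_integral_add) (auto simp: nn_integral_cmult nn_integral_cmult_indicator emeasure_\<nu>_cube W_def)
  also have "\<dots> \<le> ennreal u * ennreal W + ennreal (u powr (1 - p)) * ennreal J"
    by (intro add_left_mono mult_left_mono J) simp
  also have "\<dots> = ennreal (u * W + u powr (1 - p) * J)"
    using u W \<open>0 < J\<close> by (simp add: ennreal_mult)
  also have "u * W = W powr (1 - 1 / p) * J powr (1 / p)"
    using W \<open>0 < J\<close> by (simp add: u_def powr_divide powr_diff)
  also have "u powr (1 - p) * J = W powr (1 - 1 / p) * J powr (1 / p)"
  proof -
    have "u powr (1 - p) = (J / W) powr (1 / p - 1)"
      using \<open>1 < p\<close> by (simp add: u_def powr_powr diff_divide_distrib)
    also have "\<dots> * J = W powr (1 - 1 / p) * J powr (1 / p)"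
      using W \<open>0 < J\<close> by (simp add: powr_divide powr_diff field_simps)
    finally show ?thesis .
  qed
  finally show ?thesis by (simp add: W_def mult_ac)
qed

section \<open>Fractional averages over large and small cubes\<close>

lemma fractional_average_large:
  assumes f: "f \<in> borel_measurable lebesgue" and "1 < p" "0 < N"
    and pq: "1 / q = 1 / p - \<alpha>" "0 < q" and \<kappa>: "\<kappa> < p / q"
    and N: "\<And>c s. 0 < s \<Longrightarrow> (\<integral>\<^sup>+y\<in>cube c s. ennreal (\<bar>f y\<bar> powr p) \<partial>\<nu>) \<le> ennreal (N powr p * w c s powr \<kappa>)"
    and "0 < r" "r \<le> s" "x \<in> cube a r" "x \<in> cube c s"
  shows "ennreal (w c s powr (\<alpha> - 1)) * (\<integral>\<^sup>+y\<in>cube c s. ennreal \<bar>f y\<bar> \<partial>\<nu>) \<le>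
    ennreal (2 * N * (C * 3 ^ DIM('a)) powr (1 / q - \<kappa> / p) * w a r powr (\<kappa> / p - 1 / q))"
proof -
  define W where "W = w c s"
  have s: "0 < s" using assms by linarith
  have W: "0 < W" unfolding W_def using s by (rule w_pos)
  have V: "0 < w a r" using \<open>0 < r\<close> by (rule w_pos)
  have D: "0 < C * 3 ^ DIM('a)" using C_ge_1 by simp
  \<comment> \<open>Both cubes contain x and s is at least r, so the fixed cube lies in the triple
    of the large one; doubling then bounds W from below.\<close>
  have "cube a r \<subseteq> cube (c - s *\<^sub>R One) (3 * s)"
    using assms by (intro cube_subset_triple) auto
  then have VW: "w a r \<le> C * 3 ^ DIM('a) * W"
    unfolding W_def using w_triple[OF s, of c] w_mono by (meson order_trans)
  have "(\<integral>\<^sup>+y\<in>cube c s. ennreal \<bar>f y\<bar> \<partial>\<nu>) \<le> ennreal (2 * W powr (1 - 1 / p) * (N powr p * W powr \<kappa>) powr (1 / p))"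
    unfolding W_def using N[OF s, of c] f s \<open>1 < p\<close> \<open>0 < N\<close> W by (intro nn_integral_le_powr) (auto simp: W_def)
  then have "ennreal (W powr (\<alpha> - 1)) * (\<integral>\<^sup>+y\<in>cube c s. ennreal \<bar>f y\<bar> \<partial>\<nu>) \<le>
      ennreal (W powr (\<alpha> - 1)) * ennreal (2 * W powr (1 - 1 / p) * (N powr p * W powr \<kappa>) powr (1 / p))"
    by (rule mult_left_mono) simp
  also have "\<dots> = ennreal (2 * N * W powr (\<alpha> - 1 + (1 - 1 / p) + \<kappa> / p))"
    unfolding powr_add using \<open>0 < N\<close> \<open>1 < p\<close>
    by (simp add: ennreal_mult[symmetric] powr_mult powr_powr mult_ac)
  also have "\<alpha> - 1 + (1 - 1 / p) + \<kappa> / p = \<kappa> / p - 1 / q"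
    using pq by simp
  \<comment> \<open>The exponent is negative by \<kappa> < p / q, so a lower bound on W becomes an
    upper bound here.\<close>
  also have "W powr (\<kappa> / p - 1 / q) \<le> (w a r / (C * 3 ^ DIM('a))) powr (\<kappa> / p - 1 / q)"
    using VW V D \<kappa> pq(2) \<open>1 < p\<close> by (intro powr_mono2') (auto simp: field_simps)
  also have "\<dots> = (C * 3 ^ DIM('a)) powr (1 / q - \<kappa> / p) * w a r powr (\<kappa> / p - 1 / q)"
    using V D powr_minus[of "C * 3 ^ DIM('a)" "\<kappa> / p - 1 / q"]
    by (subst powr_divide) (auto simp: divide_inverse)
  finally show ?thesis
    using \<open>0 < N\<close> by (simp add: W_def mult_left_mono ennreal_leI mult.assoc)
qed

text \<open>The enclosing rational cube has side at most 2s, so doubling controls its measure by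
  that of the given cube.\<close>

lemma nn_integral_le_maximal:
  assumes "0 < s" "x \<in> cube c s"
  shows "(\<integral>\<^sup>+y\<in>cube c s. g y \<partial>\<nu>) \<le> ennreal (C * 2 ^ DIM('a) * w c s) * maximal g x"
proof -
  from rat_cube_superset[OF \<open>0 < s\<close>, of c] obtain d t where
    dt: "(d, t) \<in> rat_cubes" "cube c s \<subseteq> cube d t" "s \<le> t" "t \<le> 2 * s" by metis
  have t: "0 < t" using rat_cubes_pos dt by blast
  have "(\<integral>\<^sup>+y\<in>cube c s. g y \<partial>\<nu>) \<le> (\<integral>\<^sup>+y\<in>cube d t. g y \<partial>\<nu>)"
    using dt by (intro nn_integral_mono) (auto split: split_indicator)
  also have "\<dots> = ennreal (w d t) * (ennreal (1 / w d t) * (\<integral>\<^sup>+y\<in>cube d t. g y \<partial>\<nu>))"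
    using w_pos[OF t, of d] by (simp add: mult.assoc[symmetric] ennreal_mult[symmetric])
  also have "\<dots> \<le> ennreal (w d t) * maximal g x"
    unfolding maximal_def using dt assms
    by (intro mult_left_mono SUP_upper2[of "(d, t)"]) (auto split: split_indicator)
  also have "\<dots> \<le> ennreal (C * 2 ^ DIM('a) * w c s) * maximal g x"
    using w_doubling[OF dt(2) assms(1) dt(4) t] by (intro mult_right_mono ennreal_leI) auto
  finally show ?thesis .
qed

text \<open>Hedberg's trick: one factor of the average is controlled by the maximal function, the
  other by the \<open>L\<^sup>p\<close> norm; the powers of the measure of the cube cancel by the relation
  between \<open>p\<close>, \<open>q\<close> and \<open>\<alpha>\<close>.\<close>
lemma fractional_average_small:
  assumes g [measurable]: "g \<in> borel_measurable lebesgue" and "1 < p" "p \<le> q" "0 < J"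
    and pq: "1 / q = 1 / p - \<alpha>"
    and J: "(\<integral>\<^sup>+y. ennreal (\<bar>g y\<bar> powr p) \<partial>\<nu>) \<le> ennreal J"
    and s: "0 < s" and x: "x \<in> cube c s"
  shows "enn_powr (ennreal (w c s powr (\<alpha> - 1)) * (\<integral>\<^sup>+y\<in>cube c s. ennreal \<bar>g y\<bar> \<partial>\<nu>)) q \<le>
    ennreal ((C * 2 ^ DIM('a)) powr p * 2 powr (q - p) * J powr ((q - p) / p)) *
      enn_powr (maximal (\<lambda>y. ennreal \<bar>g y\<bar>) x) p"
proof -
  define W where "W = w c s"
  define D where "D = C * 2 ^ DIM('a)"
  define E where "E = D powr p * 2 powr (q - p) * J powr ((q - p) / p)"
  have W: "0 < W" unfolding W_def using s by (rule w_pos)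
  have D: "0 < D" using C_ge_1 by (simp add: D_def)
  have E: "0 < E" using D \<open>0 < J\<close> by (simp add: E_def)
  have q: "0 < q" using assms by linarith
  have "(\<integral>\<^sup>+y\<in>cube c s. ennreal (\<bar>g y\<bar> powr p) \<partial>\<nu>) \<le> (\<integral>\<^sup>+y. ennreal (\<bar>g y\<bar> powr p) \<partial>\<nu>)"
    by (intro nn_integral_mono) (auto split: split_indicator)
  also note J
  finally have A1: "(\<integral>\<^sup>+y\<in>cube c s. ennreal \<bar>g y\<bar> \<partial>\<nu>) \<le> ennreal (2 * W powr (1 - 1 / p) * J powr (1 / p))"
    unfolding W_def by (intro nn_integral_le_powr g s \<open>1 < p\<close> \<open>0 < J\<close>)
  then have "(\<integral>\<^sup>+y\<in>cube c s. ennreal \<bar>g y\<bar> \<partial>\<nu>) < top"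
    by (rule le_less_trans) simp
  then obtain A where A: "0 \<le> A" "(\<integral>\<^sup>+y\<in>cube c s. ennreal \<bar>g y\<bar> \<partial>\<nu>) = ennreal A"
    by (cases "\<integral>\<^sup>+y\<in>cube c s. ennreal \<bar>g y\<bar> \<partial>\<nu>" rule: ennreal_cases) auto
  have A_le1: "A \<le> 2 * W powr (1 - 1 / p) * J powr (1 / p)"
    using A1 A by simp
  show ?thesis
  proof (cases "maximal (\<lambda>y. ennreal \<bar>g y\<bar>) x" rule: ennreal_cases)
    case top
    then show ?thesis
      unfolding D_def[symmetric] E_def[symmetric] using E by (simp add: enn_powr_def ennreal_mult_top)
  next
    case (real m)
    have "ennreal A \<le> ennreal (D * W) * ennreal m"
      using nn_integral_le_maximal[OF s x, of "\<lambda>y. ennreal \<bar>g y\<bar>"] A real by (simp add: D_def W_def)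
    then have A_le2: "A \<le> D * W * m"
      using D W real by (simp add: ennreal_mult[symmetric])
    \<comment> \<open>The p-th power of A goes to the maximal function and the remaining q - p \<ge>
      0 to the bound by J.\<close>
    have "(W powr (\<alpha> - 1) * A) powr q = W powr (q * (\<alpha> - 1)) * (A powr p * A powr (q - p))"
      using A by (simp add: powr_mult powr_powr powr_add[symmetric] mult.commute)
    also have "\<dots> \<le> W powr (q * (\<alpha> - 1)) * ((D * W * m) powr p * (2 * W powr (1 - 1 / p) * J powr (1 / p)) powr (q - p))"
      using A A_le1 A_le2 \<open>1 < p\<close> \<open>p \<le> q\<close> by (intro mult_left_mono mult_mono powr_mono2) auto
    also have "\<dots> = E * m powr p * W powr (q * (\<alpha> - 1) + p + (1 - 1 / p) * (q - p))"
      using D W real \<open>0 < J\<close> by (simp add: E_def powr_mult powr_powr powr_add mult_ac)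
    also have "q * (\<alpha> - 1) + p + (1 - 1 / p) * (q - p) = q * (\<alpha> - 1 / p) + 1"
      using \<open>1 < p\<close> by (simp add: field_simps)
    also have "\<alpha> - 1 / p = - (1 / q)" using pq by simp
    also have "q * - (1 / q) + 1 = 0" using q by simp
    finally have "(W powr (\<alpha> - 1) * A) powr q \<le> E * m powr p" using W by simp
    then have "ennreal ((W powr (\<alpha> - 1) * A) powr q) \<le> ennreal (E * m powr p)"
      by (rule ennreal_leI)
    then show ?thesis
      using A real E by (simp add: enn_powr_ennreal ennreal_mult[symmetric] E_def[symmetric] D_def[symmetric] W_def[symmetric])
  qed
qed

text \<open>Cubes through x of side at most r lie in the triple \<open>Q'\<close>, so there f may be
  cut off to \<open>Q'\<close>, where the Morrey bound makes it p-integrable against \<nu>. The two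
  summands of B correspond to small and large cubes; their sum dominates both cases.\<close>

lemma max_comm_powr_le:
  fixes a :: 'a and b f :: "'a \<Rightarrow> real" and r p q \<alpha> \<kappa> K N :: real
  assumes f: "f \<in> borel_measurable lebesgue" and pq: "1 < p" "p \<le> q" "1 / q = 1 / p - \<alpha>"
    and \<kappa>: "\<kappa> < p / q" and "0 < K" "0 < N"
    and Lip: "AE y in lebesgue. \<forall>a r. 0 < r \<longrightarrow> y \<in> cube a r \<longrightarrow>
      \<bar>b y - avg b (cube a r)\<bar> \<le> K * w a r powr \<alpha> * \<mu> y"
    and N: "\<And>c s. 0 < s \<Longrightarrow> (\<integral>\<^sup>+y\<in>cube c s. ennreal (\<bar>f y\<bar> powr p) \<partial>\<nu>) \<le> ennreal (N powr p * w c s powr \<kappa>)"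
    and r: "0 < r"
  defines "Q' \<equiv> cube (a - r *\<^sub>R One) (3 * r)"
  defines "B \<equiv> \<lambda>x. ennreal ((C * 2 ^ DIM('a)) powr p * 2 powr (q - p) * (N powr p * wmeas \<mu> Q' powr \<kappa>) powr ((q - p) / p)) *
      enn_powr (maximal (\<lambda>y. ennreal \<bar>f y * indicator Q' y\<bar>) x) p +
      ennreal ((2 * N * (C * 3 ^ DIM('a)) powr (1 / q - \<kappa> / p) * w a r powr (\<kappa> / p - 1 / q)) powr q)"
  shows "AE x in lebesgue. x \<in> cube a r \<longrightarrow> enn_powr (max_comm b f x) q * ennreal (\<mu> x powr (1 - q)) \<le>
    ennreal ((2 * K * C * 2 ^ DIM('a)) powr q) * (ennreal (\<mu> x) * B x)"
  using Lip AE_w_le AE_pos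
proof (eventually_elim, intro impI)
  fix x assume x: "\<forall>a r. 0 < r \<longrightarrow> x \<in> cube a r \<longrightarrow> \<bar>b x - avg b (cube a r)\<bar> \<le> K * w a r powr \<alpha> * \<mu> x"
    and wx: "\<forall>a r. 0 < r \<longrightarrow> x \<in> cube a r \<longrightarrow> w a r \<le> C * 2 ^ DIM('a) * r ^ DIM('a) * \<mu> x"
    and pos: "0 < \<mu> x" and xQ: "x \<in> cube a r"
  define L where "L = 2 * K * C * 2 ^ DIM('a)"
  have L: "0 < L" using C_ge_1 \<open>0 < K\<close> by (simp add: L_def)
  have q: "0 < q" using pq by linarith
  define g where "g y = f y * indicator Q' y" for y
  define c2 where "c2 = 2 * N * (C * 3 ^ DIM('a)) powr (1 / q - \<kappa> / p) * w a r powr (\<kappa> / p - 1 / q)"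
  have c2: "0 \<le> c2" using \<open>0 < N\<close> by (simp add: c2_def)
  have [measurable]: "Q' \<in> sets lebesgue" by (simp add: Q'_def)
  have g: "g \<in> borel_measurable lebesgue" unfolding g_def using f by measurable
  have W': "0 < wmeas \<mu> Q'" unfolding Q'_def using r by (intro w_pos) simp
  have J: "(\<integral>\<^sup>+y. ennreal (\<bar>g y\<bar> powr p) \<partial>\<nu>) \<le> ennreal (N powr p * wmeas \<mu> Q' powr \<kappa>)"
  proof -
    have "(\<integral>\<^sup>+y. ennreal (\<bar>g y\<bar> powr p) \<partial>\<nu>) = (\<integral>\<^sup>+y\<in>Q'. ennreal (\<bar>f y\<bar> powr p) \<partial>\<nu>)"
      by (intro nn_integral_cong) (auto simp: g_def split: split_indicator)
    also have "\<dots> \<le> ennreal (N powr p * wmeas \<mu> Q' powr \<kappa>)"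
      unfolding Q'_def using r by (intro N) simp
    finally show ?thesis .
  qed
  show "enn_powr (max_comm b f x) q * ennreal (\<mu> x powr (1 - q)) \<le>
    ennreal ((2 * K * C * 2 ^ DIM('a)) powr q) * (ennreal (\<mu> x) * B x)"
  \<comment> \<open>If B is infinite, positivity of \<mu>(x) and of the constant makes the
    right-hand side infinite; otherwise roots can be taken among reals.\<close>
  proof (cases "B x" rule: ennreal_cases)
    case top
    then show ?thesis
      unfolding L_def[symmetric] using L pos by (simp add: ennreal_mult_top)
  next
    case (real t)
    have small: "enn_powr (ennreal (w c s powr (\<alpha> - 1)) * (\<integral>\<^sup>+y\<in>cube c s. ennreal \<bar>f y\<bar> \<partial>\<nu>)) q \<le> ennreal t"
      if "0 < s" "x \<in> cube c s" "s \<le> r" for c s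
    proof -
      have "cube c s \<subseteq> Q'"
        unfolding Q'_def using that xQ by (intro cube_subset_triple) auto
      then have "(\<integral>\<^sup>+y\<in>cube c s. ennreal \<bar>f y\<bar> \<partial>\<nu>) = (\<integral>\<^sup>+y\<in>cube c s. ennreal \<bar>g y\<bar> \<partial>\<nu>)"
        by (intro nn_integral_cong) (auto simp: g_def split: split_indicator)
      then have "enn_powr (ennreal (w c s powr (\<alpha> - 1)) * (\<integral>\<^sup>+y\<in>cube c s. ennreal \<bar>f y\<bar> \<partial>\<nu>)) q \<le>
          ennreal ((C * 2 ^ DIM('a)) powr p * 2 powr (q - p) * (N powr p * wmeas \<mu> Q' powr \<kappa>) powr ((q - p) / p)) *
            enn_powr (maximal (\<lambda>y. ennreal \<bar>g y\<bar>) x) p"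
        using fractional_average_small[OF g pq(1,2) _ pq(3) J that(1,2)] \<open>0 < N\<close> W' by simp
      also have "\<dots> \<le> B x" unfolding B_def g_def by (simp add: add_increasing2)
      finally show ?thesis using real by simp
    qed
    have large: "enn_powr (ennreal (w c s powr (\<alpha> - 1)) * (\<integral>\<^sup>+y\<in>cube c s. ennreal \<bar>f y\<bar> \<partial>\<nu>)) q \<le> ennreal t"
      if "0 < s" "x \<in> cube c s" "r \<le> s" for c s
    proof -
      have "ennreal (w c s powr (\<alpha> - 1)) * (\<integral>\<^sup>+y\<in>cube c s. ennreal \<bar>f y\<bar> \<partial>\<nu>) \<le> ennreal c2"
        unfolding c2_def
        by (rule fractional_average_large[OF f pq(1) \<open>0 < N\<close> pq(3) q \<kappa> N r that(3) xQ that(2)])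
      then have "enn_powr (ennreal (w c s powr (\<alpha> - 1)) * (\<integral>\<^sup>+y\<in>cube c s. ennreal \<bar>f y\<bar> \<partial>\<nu>)) q \<le> enn_powr (ennreal c2) q"
        using q by (intro enn_powr_mono) auto
      also have "\<dots> \<le> B x" using c2 by (simp add: enn_powr_ennreal B_def c2_def add_increasing)
      finally show ?thesis using real by simp
    qed
    have "max_comm b f x \<le> ennreal (L * \<mu> x) * ennreal (t powr (1 / q))"
      unfolding max_comm_def
    proof (rule SUP_least)
      fix P :: "'a set" assume "P \<in> {Q \<in> cubes. x \<in> Q}"
      then obtain c s where cs: "0 < s" "P = cube c s" "x \<in> cube c s" by (auto simp: cubes_iff)
      have "ennreal (w c s powr (\<alpha> - 1)) * (\<integral>\<^sup>+y\<in>cube c s. ennreal \<bar>f y\<bar> \<partial>\<nu>) \<le> ennreal (t powr (1 / q))"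
        using small[of s c] large[of s c] cs q real linear[of s r]
        by (intro enn_powr_le_imp_le) blast+
      then have "ennreal (L * \<mu> x) * (ennreal (w c s powr (\<alpha> - 1)) * (\<integral>\<^sup>+y\<in>cube c s. ennreal \<bar>f y\<bar> \<partial>\<nu>))
          \<le> ennreal (L * \<mu> x) * ennreal (t powr (1 / q))"
        by (rule mult_left_mono) simp
      with max_comm_le[OF \<open>0 < K\<close> f Lip x wx cs(1,3)]
      show "ennreal (1 / measure lebesgue P) * (\<integral>\<^sup>+y\<in>P. ennreal (\<bar>b x - b y\<bar> * \<bar>f y\<bar>) \<partial>lebesgue)
          \<le> ennreal (L * \<mu> x) * ennreal (t powr (1 / q))"
        unfolding cs(2) L_def by (rule order_trans)
    qed
    also have "\<dots> = ennreal (L * \<mu> x * t powr (1 / q))"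
      using L by (simp add: ennreal_mult)
    finally have "enn_powr (max_comm b f x) q \<le> enn_powr (ennreal (L * \<mu> x * t powr (1 / q))) q"
      using q by (intro enn_powr_mono) auto
    also have "\<dots> = ennreal (L powr q * \<mu> x powr q * t)"
      using L q real by (simp add: enn_powr_ennreal powr_mult powr_powr)
    finally have "enn_powr (max_comm b f x) q * ennreal (\<mu> x powr (1 - q)) \<le>
        ennreal (L powr q * \<mu> x powr q * t) * ennreal (\<mu> x powr (1 - q))"
      by (rule mult_right_mono) simp
    also have "\<dots> = ennreal (L powr q * (\<mu> x powr q * \<mu> x powr (1 - q)) * t)"
      using real by (simp add: ennreal_mult[symmetric] mult_ac)
    \<comment> \<open>Here the target weight turns the q-th power of \<mu>(x) into the density of
      \<nu>.\<close>
    also have "\<mu> x powr q * \<mu> x powr (1 - q) = \<mu> x"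
      using pos by (simp add: powr_add[symmetric])
    finally show ?thesis
      unfolding L_def[symmetric] using real by (simp add: ennreal_mult mult.assoc)
  qed
qed

lemma max_comm_integral_le:
  assumes f [measurable]: "f \<in> borel_measurable lebesgue" and pq: "1 < p" "p \<le> q" "1 / q = 1 / p - \<alpha>"
    and \<kappa>: "0 < \<kappa>" "\<kappa> < p / q" and "0 < K" "0 < N"
    and Lip: "AE y in lebesgue. \<forall>a r. 0 < r \<longrightarrow> y \<in> cube a r \<longrightarrow>
      \<bar>b y - avg b (cube a r)\<bar> \<le> K * w a r powr \<alpha> * \<mu> y"
    and N: "\<And>c s. 0 < s \<Longrightarrow> (\<integral>\<^sup>+y\<in>cube c s. ennreal (\<bar>f y\<bar> powr p) \<partial>\<nu>) \<le> ennreal (N powr p * w c s powr \<kappa>)"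
    and r: "0 < r"
  shows "(\<integral>\<^sup>+x\<in>cube a r. enn_powr (max_comm b f x) q * ennreal (\<mu> x powr (1 - q)) \<partial>lebesgue) \<le>
    ennreal ((2 * K * C * 2 ^ DIM('a)) powr q *
      ((C * 2 ^ DIM('a)) powr p * 2 powr (q - p) * strong_const p * (C * 3 ^ DIM('a)) powr (\<kappa> * q / p) +
       (2 * (C * 3 ^ DIM('a)) powr (1 / q - \<kappa> / p)) powr q) * (N powr q * w a r powr (\<kappa> * q / p)))"
proof -
  define L where "L = (2 * K * C * 2 ^ DIM('a)) powr q"
  define k1 where "k1 = (C * 2 ^ DIM('a)) powr p * 2 powr (q - p)"
  define D where "D = C * 3 ^ DIM('a)"
  define V where "V = w a r"
  define Q' where "Q' = cube (a - r *\<^sub>R One) (3 * r)"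
  define J where "J = N powr p * wmeas \<mu> Q' powr \<kappa>"
  define g where "g y = f y * indicator Q' y" for y
  define G where "G x = enn_powr (maximal (\<lambda>y. ennreal \<bar>g y\<bar>) x) p" for x
  define c2 where "c2 = (2 * N * D powr (1 / q - \<kappa> / p) * V powr (\<kappa> / p - 1 / q)) powr q"
  define c1 where "c1 = k1 * J powr ((q - p) / p)"
  have q: "0 < q" using pq by linarith
  have V: "0 < V" unfolding V_def using r by (rule w_pos)
  have D: "0 < D" using C_ge_1 by (simp add: D_def)
  have S: "0 < strong_const p" using pq(1) by (rule strong_const_pos)
  have nonneg: "0 \<le> c1" "0 \<le> c2" "0 \<le> J" "0 \<le> L" "0 \<le> k1"
    using \<open>0 < N\<close> by (simp_all add: c1_def c2_def J_def L_def k1_def)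
  have [measurable]: "Q' \<in> sets lebesgue" by (simp add: Q'_def)
  have [measurable]: "g \<in> borel_measurable lebesgue" unfolding g_def by measurable
  have [measurable]: "G \<in> borel_measurable lebesgue" unfolding G_def by measurable
  have J: "(\<integral>\<^sup>+y. ennreal (\<bar>g y\<bar> powr p) \<partial>\<nu>) \<le> ennreal J"
  proof -
    have "(\<integral>\<^sup>+y. ennreal (\<bar>g y\<bar> powr p) \<partial>\<nu>) = (\<integral>\<^sup>+y\<in>Q'. ennreal (\<bar>f y\<bar> powr p) \<partial>\<nu>)"
      by (intro nn_integral_cong) (auto simp: g_def split: split_indicator)
    also have "\<dots> \<le> ennreal J"
      unfolding J_def Q'_def using r by (intro N) simp
    finally show ?thesis .
  qed
  have "(\<integral>\<^sup>+x. G x \<partial>\<nu>) \<le> ennreal (strong_const p) * (\<integral>\<^sup>+x. ennreal (\<bar>g x\<bar> powr p) \<partial>\<nu>)"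
    unfolding G_def using pq(1) by (intro maximal_strong_type) auto
  also have "\<dots> \<le> ennreal (strong_const p) * ennreal J"
    by (intro mult_left_mono J) simp
  finally have G: "(\<integral>\<^sup>+x. G x \<partial>\<nu>) \<le> ennreal (strong_const p * J)"
    using S nonneg by (simp add: ennreal_mult)
  have AE: "AE x in lebesgue. x \<in> cube a r \<longrightarrow> enn_powr (max_comm b f x) q * ennreal (\<mu> x powr (1 - q)) \<le>
      ennreal L * (ennreal (\<mu> x) * (ennreal c1 * G x + ennreal c2))"
    unfolding L_def c1_def c2_def k1_def D_def V_def J_def Q'_def G_def g_def
    by (rule max_comm_powr_le[OF f pq \<kappa>(2) \<open>0 < K\<close> \<open>0 < N\<close> Lip _ r]) (rule N)
  have "(\<integral>\<^sup>+x\<in>cube a r. enn_powr (max_comm b f x) q * ennreal (\<mu> x powr (1 - q)) \<partial>lebesgue) \<le>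
      (\<integral>\<^sup>+x. ennreal L * (ennreal (\<mu> x) * (ennreal c1 * G x * indicator (cube a r) x + ennreal c2 * indicator (cube a r) x)) \<partial>lebesgue)"
    using AE by (intro nn_integral_mono_AE, elim eventually_mono) (auto split: split_indicator)
  also have "\<dots> = ennreal L * (\<integral>\<^sup>+x. ennreal c1 * G x * indicator (cube a r) x + ennreal c2 * indicator (cube a r) x \<partial>\<nu>)"
    by (simp add: nn_integral_cmult nn_integral_\<nu>)
  \<comment> \<open>The maximal term is enlarged to the whole space, where the strong-type bound
    applies; the cut-off built into g keeps the result local. The constant term stays restricted to
    the cube.\<close>
  also have "(\<integral>\<^sup>+x. ennreal c1 * G x * indicator (cube a r) x + ennreal c2 * indicator (cube a r) x \<partial>\<nu>) \<le>
      (\<integral>\<^sup>+x. ennreal c1 * G x + ennreal c2 * indicator (cube a r) x \<partial>\<nu>)"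
    by (intro nn_integral_mono) (auto split: split_indicator)
  also have "\<dots> = ennreal c1 * (\<integral>\<^sup>+x. G x \<partial>\<nu>) + ennreal c2 * ennreal V"
    by (simp add: nn_integral_add nn_integral_cmult nn_integral_cmult_indicator emeasure_\<nu>_cube V_def)
  also have "\<dots> \<le> ennreal c1 * ennreal (strong_const p * J) + ennreal c2 * ennreal V"
    by (intro add_right_mono mult_left_mono G) simp
  also have "\<dots> = ennreal (c1 * (strong_const p * J) + c2 * V)"
    using nonneg S V by (simp add: ennreal_mult)
  also have "c1 * (strong_const p * J) \<le> k1 * strong_const p * D powr (\<kappa> * q / p) * (N powr q * V powr (\<kappa> * q / p))"
  proof -
    \<comment> \<open>One factor comes from Hedberg's bound and one from the strong-type bound;
      together they form J^(q/p), which scales like N^q times the measure of the cube to the power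
      \<kappa> q / p.\<close>
    have "J powr ((q - p) / p) * J = J powr ((q - p) / p + 1)"
      using nonneg by (simp add: powr_add)
    also have "(q - p) / p + 1 = q / p" using pq by (simp add: field_simps)
    also have "J powr (q / p) = N powr q * wmeas \<mu> Q' powr (\<kappa> * q / p)"
      using \<open>0 < N\<close> pq by (simp add: J_def powr_mult powr_powr)
    also have "\<dots> \<le> N powr q * (D * V) powr (\<kappa> * q / p)"
      unfolding Q'_def D_def V_def using w_triple[OF r, of a] \<kappa> pq q
      by (intro mult_left_mono powr_mono2) auto
    also have "\<dots> = D powr (\<kappa> * q / p) * (N powr q * V powr (\<kappa> * q / p))"
      using D V by (simp add: powr_mult)
    finally have "k1 * strong_const p * (J powr ((q - p) / p) * J) \<le>
        k1 * strong_const p * (D powr (\<kappa> * q / p) * (N powr q * V powr (\<kappa> * q / p)))"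
      using nonneg S by (intro mult_left_mono) auto
    then show ?thesis by (simp add: c1_def mult_ac)
  qed
  also have "c2 * V = (2 * D powr (1 / q - \<kappa> / p)) powr q * (N powr q * V powr (\<kappa> * q / p))"
  proof -
    \<comment> \<open>Integrating the constant over the cube adds one power of V, which cancels the
      -1 and leaves the same scaling as in the maximal term.\<close>
    have "V powr ((\<kappa> / p - 1 / q) * q) * V = V powr ((\<kappa> / p - 1 / q) * q + 1)"
      using V by (simp add: powr_add)
    also have "(\<kappa> / p - 1 / q) * q + 1 = \<kappa> * q / p"
      using q by (simp add: left_diff_distrib)
    finally show ?thesis
      using \<open>0 < N\<close> by (simp add: c2_def powr_mult powr_powr mult_ac)
  qed
  finally have "(\<integral>\<^sup>+x\<in>cube a r. enn_powr (max_comm b f x) q * ennreal (\<mu> x powr (1 - q)) \<partial>lebesgue) \<le>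
      ennreal L * ennreal (k1 * strong_const p * D powr (\<kappa> * q / p) * (N powr q * V powr (\<kappa> * q / p)) +
        (2 * D powr (1 / q - \<kappa> / p)) powr q * (N powr q * V powr (\<kappa> * q / p)))"
    by (simp add: mult_left_mono ennreal_leI)
  also have "\<dots> = ennreal (L * (k1 * strong_const p * D powr (\<kappa> * q / p) +
        (2 * D powr (1 / q - \<kappa> / p)) powr q) * (N powr q * V powr (\<kappa> * q / p)))"
    using nonneg by (simp add: ennreal_mult'[symmetric] algebra_simps)
  finally show ?thesis unfolding L_def k1_def D_def V_def .
qed

section \<open>Passage from integral bounds to Morrey norms\<close>

lemma integral_le_if_morrey_norm_le:
  assumes [measurable]: "f \<in> borel_measurable lebesgue" and "1 < p" "0 < N" "0 < s"
    and N: "morrey_norm p \<kappa> \<mu> \<mu> (\<lambda>x. ennreal \<bar>f x\<bar>) \<le> ennreal N"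
  shows "(\<integral>\<^sup>+y\<in>cube c s. ennreal (\<bar>f y\<bar> powr p) \<partial>\<nu>) \<le> ennreal (N powr p * w c s powr \<kappa>)"
proof -
  let ?I = "\<integral>\<^sup>+y\<in>cube c s. enn_powr (ennreal \<bar>f y\<bar>) p * ennreal (\<mu> y) \<partial>lebesgue"
  have W: "0 < w c s" using \<open>0 < s\<close> by (rule w_pos)
  have I: "(\<integral>\<^sup>+y\<in>cube c s. ennreal (\<bar>f y\<bar> powr p) \<partial>\<nu>) = ?I"
    by (subst nn_integral_\<nu>) (auto intro!: nn_integral_cong simp: enn_powr_ennreal mult_ac)
  have "enn_powr (ennreal (1 / w c s powr \<kappa>) * ?I) (1 / p) \<le> morrey_norm p \<kappa> \<mu> \<mu> (\<lambda>x. ennreal \<bar>f x\<bar>)"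
    unfolding morrey_norm_def using \<open>0 < s\<close> by (intro SUP_upper2[of "cube c s"]) auto
  also note N
  finally have "ennreal (1 / w c s powr \<kappa>) * ?I \<le> ennreal (N powr (1 / (1 / p)))"
    using assms by (intro enn_powr_le_imp_le) auto
  then have "ennreal (w c s powr \<kappa>) * (ennreal (1 / w c s powr \<kappa>) * ?I) \<le> ennreal (w c s powr \<kappa>) * ennreal (N powr p)"
    by (intro mult_left_mono) auto
  moreover have "ennreal (w c s powr \<kappa>) * (ennreal (1 / w c s powr \<kappa>) * ?I) = ?I"
    using W by (simp add: mult.assoc[symmetric] ennreal_mult[symmetric])
  ultimately show ?thesis using I by (simp add: ennreal_mult[symmetric] mult.commute)
qed

lemma max_comm_bounded_if_Lip:
  assumes Lip: "b \<in> Lip_w \<beta> \<mu>" and \<beta>: "0 < \<beta>" and p: "1 < p" and q: "p \<le> q"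
    and pq: "1 / q = 1 / p - \<beta> / real DIM('a)" and \<kappa>: "0 < \<kappa>" "\<kappa> < p / q"
  shows "\<exists>M>0. \<forall>f\<in>morrey_space p \<kappa> \<mu> \<mu>.
    morrey_norm q (\<kappa> * q / p) (\<lambda>x. \<mu> x powr (1 - q)) \<mu> (max_comm b f)
      \<le> ennreal M * morrey_norm p \<kappa> \<mu> \<mu> (\<lambda>x. ennreal \<bar>f x\<bar>)"
proof -
  let ?\<alpha> = "\<beta> / real DIM('a)"
  have b: "locally_integrable b" using Lip by (simp add: Lip_w_def)
  obtain B where B: "\<And>Q. Q \<in> cubes \<Longrightarrow>
      1 / wmeas \<mu> Q powr ?\<alpha> * (1 / wmeas \<mu> Q) * (LINT x:Q|lebesgue. \<bar>b x - avg b Q\<bar>) \<le> B"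
    using Lip by (auto simp: Lip_w_def)
  have "(LINT y:cube a r|lebesgue. \<bar>b y - avg b (cube a r)\<bar>) \<le> \<bar>B\<bar> * w a r powr (1 + ?\<alpha>)"
    if "0 < r" for a r
  proof -
    have W: "0 < w a r" using that by (rule w_pos)
    have "1 / w a r powr ?\<alpha> * (1 / w a r) * (LINT y:cube a r|lebesgue. \<bar>b y - avg b (cube a r)\<bar>) \<le> \<bar>B\<bar>"
      using B[of "cube a r"] that by force
    then have "(LINT y:cube a r|lebesgue. \<bar>b y - avg b (cube a r)\<bar>) \<le> \<bar>B\<bar> * (w a r powr 1 * w a r powr ?\<alpha>)"
      using W by (simp add: field_simps)
    then show ?thesis by (simp only: powr_add)
  qed
  then obtain K where K: "0 < K" "AE x in lebesgue. \<forall>a r. 0 < r \<longrightarrow> x \<in> cube a r \<longrightarrow>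
      \<bar>b x - avg b (cube a r)\<bar> \<le> K * w a r powr ?\<alpha> * \<mu> x"
    using AE_abs_diff_avg_le[OF b, of "\<bar>B\<bar>" ?\<alpha>] \<beta> by auto
  define M where "M = (2 * K * C * 2 ^ DIM('a)) powr q *
      ((C * 2 ^ DIM('a)) powr p * 2 powr (q - p) * strong_const p * (C * 3 ^ DIM('a)) powr (\<kappa> * q / p) +
       (2 * (C * 3 ^ DIM('a)) powr (1 / q - \<kappa> / p)) powr q)"
  have M: "0 < M"
    using K(1) C_ge_1 strong_const_pos[OF p] by (auto simp: M_def intro!: mult_pos_pos add_pos_pos)
  have q0: "0 < q" using p q by linarith
  have bound: "morrey_norm q (\<kappa> * q / p) (\<lambda>x. \<mu> x powr (1 - q)) \<mu> (max_comm b f) \<le> ennreal (M powr (1 / q) * N)"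
    if f: "f \<in> borel_measurable lebesgue" and "0 < N"
      and N: "morrey_norm p \<kappa> \<mu> \<mu> (\<lambda>x. ennreal \<bar>f x\<bar>) \<le> ennreal N" for f N
    unfolding morrey_norm_def
  proof (rule SUP_least)
    fix Q :: "'a set" assume "Q \<in> cubes"
    then obtain a r where ar: "0 < r" "Q = cube a r" by (auto simp: cubes_iff)
    let ?I = "\<integral>\<^sup>+x\<in>Q. enn_powr (max_comm b f x) q * ennreal (\<mu> x powr (1 - q)) \<partial>lebesgue"
    have W: "0 < w a r" using ar(1) by (rule w_pos)
    have "?I \<le> ennreal (M * (N powr q * w a r powr (\<kappa> * q / p)))"
      unfolding ar(2) M_def
      by (rule max_comm_integral_le[OF f p q pq \<kappa> K(1) \<open>0 < N\<close> K(2) integral_le_if_morrey_norm_le[OF f p \<open>0 < N\<close> _ N] ar(1)])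
    then have "ennreal (1 / wmeas \<mu> Q powr (\<kappa> * q / p)) * ?I \<le>
        ennreal (1 / wmeas \<mu> Q powr (\<kappa> * q / p)) * ennreal (M * (N powr q * w a r powr (\<kappa> * q / p)))"
      by (rule mult_left_mono) simp
    also have "\<dots> = ennreal (M * N powr q)"
      using W M unfolding ar(2) by (subst ennreal_mult[symmetric]) auto
    finally have "enn_powr (ennreal (1 / wmeas \<mu> Q powr (\<kappa> * q / p)) * ?I) (1 / q) \<le> enn_powr (ennreal (M * N powr q)) (1 / q)"
      using q0 by (intro enn_powr_mono) auto
    also have "\<dots> = ennreal (M powr (1 / q) * N)"
      using M q0 \<open>0 < N\<close> by (simp add: enn_powr_ennreal powr_mult powr_powr)
    finally show "enn_powr (ennreal (1 / wmeas \<mu> Q powr (\<kappa> * q / p)) * ?I) (1 / q) \<le> ennreal (M powr (1 / q) * N)" .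
  qed
  show ?thesis
  proof (intro exI[of _ "M powr (1 / q)"] conjI ballI)
    show M': "0 < M powr (1 / q)" using M by simp
    fix f assume "f \<in> morrey_space p \<kappa> \<mu> \<mu>"
    then have f: "f \<in> borel_measurable lebesgue"
      and fin: "morrey_norm p \<kappa> \<mu> \<mu> (\<lambda>x. ennreal \<bar>f x\<bar>) < \<infinity>"
      by (auto simp: morrey_space_def)
    then obtain N where N: "0 \<le> N" "morrey_norm p \<kappa> \<mu> \<mu> (\<lambda>x. ennreal \<bar>f x\<bar>) = ennreal N"
      by (cases "morrey_norm p \<kappa> \<mu> \<mu> (\<lambda>x. ennreal \<bar>f x\<bar>)" rule: ennreal_cases) auto
    show "morrey_norm q (\<kappa> * q / p) (\<lambda>x. \<mu> x powr (1 - q)) \<mu> (max_comm b f)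
      \<le> ennreal (M powr (1 / q)) * morrey_norm p \<kappa> \<mu> \<mu> (\<lambda>x. ennreal \<bar>f x\<bar>)"
    \<comment> \<open>The bound is available for strictly positive N only, whereas the norm of f may
      be 0. Enlarging N by e divided by the constant costs exactly e.\<close>
    proof (rule ennreal_le_epsilon)
      fix e :: real assume "0 < e"
      have "morrey_norm q (\<kappa> * q / p) (\<lambda>x. \<mu> x powr (1 - q)) \<mu> (max_comm b f) \<le>
          ennreal (M powr (1 / q) * (N + e / M powr (1 / q)))"
      proof (rule bound[OF f])
        show "0 < N + e / M powr (1 / q)" using N(1) \<open>0 < e\<close> M' by (intro add_nonneg_pos) auto
        show "morrey_norm p \<kappa> \<mu> \<mu> (\<lambda>x. ennreal \<bar>f x\<bar>) \<le> ennreal (N + e / M powr (1 / q))"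
          using N \<open>0 < e\<close> M' by (simp add: ennreal_leI)
      qed
      also have "M powr (1 / q) * (N + e / M powr (1 / q)) = M powr (1 / q) * N + e"
        using M' by (simp add: field_simps)
      also have "ennreal \<dots> = ennreal (M powr (1 / q)) * ennreal N + ennreal e"
        using N(1) \<open>0 < e\<close> by (simp add: ennreal_mult)
      finally show "morrey_norm q (\<kappa> * q / p) (\<lambda>x. \<mu> x powr (1 - q)) \<mu> (max_comm b f) \<le>
          ennreal (M powr (1 / q)) * morrey_norm p \<kappa> \<mu> \<mu> (\<lambda>x. ennreal \<bar>f x\<bar>) + ennreal e"
        unfolding N(2) .
    qed
  qed
qed

end

section \<open>Normalising the A1 constant; the equivalence\<close>

lemma A1_imp_A1_weight:
  assumes "A1 \<mu>"
  obtains C where "A1_weight \<mu> C"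
proof -
  from assms obtain C where w: "weight \<mu>" and C: "\<And>Q. Q \<in> cubes \<Longrightarrow> AE x in lebesgue. x \<in> Q \<longrightarrow> avg \<mu> Q \<le> C * \<mu> x"
    by (auto simp: A1_def)
  have "A1_weight \<mu> (max C 1)"
  proof
    fix Q :: "'a set" assume "Q \<in> cubes"
    from C[OF this] show "AE x in lebesgue. x \<in> Q \<longrightarrow> avg \<mu> Q \<le> max C 1 * \<mu> x"
    proof (rule eventually_mono, intro impI)
      fix x assume "x \<in> Q \<longrightarrow> avg \<mu> Q \<le> C * \<mu> x" "x \<in> Q"
      moreover have "C * \<mu> x \<le> max C 1 * \<mu> x"
        using w by (intro mult_right_mono) (auto simp: weight_def)
      ultimately show "avg \<mu> Q \<le> max C 1 * \<mu> x" by simp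
    qed
  qed (use w in auto)
  then show thesis by (rule that)
qed

theorem theorem1p1:
  fixes b \<mu> :: "'a::euclidean_space \<Rightarrow> real" and \<beta> p q \<kappa> :: real
  assumes "locally_integrable b"
    and "A1 \<mu>"
    and "0 < \<beta>" "\<beta> < 1"
    and "1 < p" "p < real DIM('a) / \<beta>"
    and "1 / q = 1 / p - \<beta> / real DIM('a)"
    and "0 < \<kappa>" "\<kappa> < p / q"
  shows "b \<in> Lip_w \<beta> \<mu> \<longleftrightarrow>
    (\<exists>C>0. \<forall>f\<in>morrey_space p \<kappa> \<mu> \<mu>.
       morrey_norm q (\<kappa> * q / p) (\<lambda>x. \<mu> x powr (1 - q)) \<mu> (max_comm b f)
         \<le> ennreal C * morrey_norm p \<kappa> \<mu> \<mu> (\<lambda>x. ennreal \<bar>f x\<bar>))"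
proof -
  obtain C where "A1_weight \<mu> C" using A1_imp_A1_weight[OF assms(2)] .
  then interpret A1_weight \<mu> C .
  \<comment> \<open>This gives 1/q > 0, which excludes negative q as well as q = 0, where 1/q has
    the default value 0.\<close>
  have "\<beta> / real DIM('a) < 1 / p"
    using assms(3,5,6) by (simp add: field_simps)
  then have q: "0 < 1 / q" "1 / q \<le> 1 / p" using assms(3,7) by auto
  then have "0 < q" by simp
  with q(2) have pq: "p \<le> q" using assms(5) by (simp add: field_simps)
  then have "p / q \<le> 1" using \<open>0 < q\<close> by simp
  then have "\<kappa> < 1" using assms(9) by linarith
  show ?thesis
  proof
    assume "b \<in> Lip_w \<beta> \<mu>"
    then show "\<exists>C>0. \<forall>f\<in>morrey_space p \<kappa> \<mu> \<mu>.
       morrey_norm q (\<kappa> * q / p) (\<lambda>x. \<mu> x powr (1 - q)) \<mu> (max_comm b f)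
         \<le> ennreal C * morrey_norm p \<kappa> \<mu> \<mu> (\<lambda>x. ennreal \<bar>f x\<bar>)"
      using max_comm_bounded_if_Lip assms pq by blast
  next
    assume "\<exists>C>0. \<forall>f\<in>morrey_space p \<kappa> \<mu> \<mu>.
       morrey_norm q (\<kappa> * q / p) (\<lambda>x. \<mu> x powr (1 - q)) \<mu> (max_comm b f)
         \<le> ennreal C * morrey_norm p \<kappa> \<mu> \<mu> (\<lambda>x. ennreal \<bar>f x\<bar>)"
    then obtain K where "0 < K" "\<And>f. f \<in> morrey_space p \<kappa> \<mu> \<mu> \<Longrightarrow>
       morrey_norm q (\<kappa> * q / p) (\<lambda>x. \<mu> x powr (1 - q)) \<mu> (max_comm b f)
         \<le> ennreal K * morrey_norm p \<kappa> \<mu> \<mu> (\<lambda>x. ennreal \<bar>f x\<bar>)" by blast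
    then show "b \<in> Lip_w \<beta> \<mu>"
      using assms pq \<open>\<kappa> < 1\<close> by (intro Lip_if_max_comm_bounded[of b \<beta> p q \<kappa> K]) auto
  qed
qed

end
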